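(* Let $t\geq 2$. Every minimally $t$-tough, claw-free graph $G$ has a vertex of degree at most $\big\lceil \frac{10t-5}{3}\big\rceil$.
   Context: All graphs are finite, simple and undirected. For $S\subseteq V(G)$, $w(G-S)$ denotes the number of connected components of $G-S$. The toughness of a non-complete graph $G$ is $\tau(G)=\min\{|S|/w(G-S): S\subseteq V(G),\ w(G-S)\geq 2\}$, and $\tau(G)=+\infty$ if $G$ is complete. A graph $G$ is minimally $t$-tough if $\tau(G)=t$ and $\tau(G-e)<t$ for every edge $e\in E(G)$. A graph is claw-free if it contains no induced subgraph isomorphic to $K_{1,3}$. *)

theory Defs
  imports Complex_Main "HOL-Library.Extended_Real" "Graph_Theory.Graph_Theory"
begin

text \<open>
  As usual in \<open>Graph_Theory\<close>, a finite simple undirected graph is a symmetric loop-free finite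
  digraph whose arcs are pairs of vertices (locale \<^locale>\<open>pair_graph\<close>): the edge \<open>uv\<close> is the pair of
  arcs \<open>(u, v)\<close>, \<open>(v, u)\<close>, and the degree of a vertex is its \<^const>\<open>out_degree\<close>.
\<close>

text \<open>
  The connected components of a graph are the strongly connected components of the symmetric
  digraph representing it.
\<close>

lemma (in sym_digraph) sccs_eq_max_connected:
  "sccs = {H. max_subgraph Digraph_Component.connected H}"
proof -
  have up: "subgraph H (G \<restriction> verts H) \<and> subgraph (G \<restriction> verts H) G" if "subgraph H G" for H
  proof -
    have "induced_subgraph (G \<restriction> verts H) G"
      using that by (intro induced_induce) auto
    then show ?thesis
      using that by (auto simp: subgraph_def compatible_def
        dest: wf_digraph.tail_in_verts wf_digraph.head_in_verts)
  qed
  have ind: "strongly_connected (G \<restriction> verts H)"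
    if "subgraph H G" "Digraph_Component.connected H" for H
  proof -
    from up[OF that(1)] have s: "subgraph H (G \<restriction> verts H)" and w: "wf_digraph (G \<restriction> verts H)"
      by (auto simp: subgraph_def)
    have "Digraph_Component.connected (G \<restriction> verts H)"
      using s by (intro wf_digraph.connected_spanning_imp_connected[OF w _ that(2)])
        (simp add: spanning_def)
    moreover have "symmetric (G \<restriction> verts H)"
      using sym_arcs unfolding symmetric_def sym_def arcs_ends_def arc_to_ends_def
      by (force simp: image_iff)
    ultimately show ?thesis
      by (intro wf_digraph.symmetric_connected_imp_strongly_connected[OF w])
  qed
  have scc: "Digraph_Component.connected H" if "strongly_connected H" "wf_digraph H" for H :: "('a, 'b) pre_digraph"
  proof -
    interpret H: wf_digraph H by fact
    have "(u, v) \<in> rtrancl_on (verts H) ((arcs_ends H)\<^sup>s)" if "u \<in> verts H" "v \<in> verts H" for u v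
    proof -
      have "(u, v) \<in> rtrancl_on (verts H) (arcs_ends H)"
        using \<open>strongly_connected H\<close> that by (auto simp: strongly_connected_def reachable_def)
      then show ?thesis
        by (rule rtrancl_on_mono[rotated 2]) (auto simp: symcl_def)
    qed
    then show ?thesis
      using that(1) by (auto simp: connected_conv strongly_connected_def)
  qed
  have "max_subgraph strongly_connected H \<longleftrightarrow> max_subgraph Digraph_Component.connected H" for H
  proof
    assume m: "max_subgraph strongly_connected H"
    then have H: "subgraph H G" "strongly_connected H"
      by (auto simp: max_subgraph_def)
    have "H' = H" if "subgraph H H'" "subgraph H' G" "Digraph_Component.connected H'" for H'
    proof -
      have eq: "G \<restriction> verts H' = H"
        using m ind[OF that(2,3)] up[OF that(2)] subgraph_trans[OF that(1)]
        unfolding max_subgraph_def by metis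
      then have "subgraph H' H"
        using up[OF that(2)] by simp
      with that(1) show ?thesis
        by (auto simp: subgraph_def compatible_def intro!: pre_digraph.equality)
    qed
    with H show "max_subgraph Digraph_Component.connected H"
      using scc unfolding max_subgraph_def by (auto simp: subgraph_def)
  next
    assume m: "max_subgraph Digraph_Component.connected H"
    then have H: "subgraph H G" "Digraph_Component.connected H"
      by (auto simp: max_subgraph_def)
    have w: "wf_digraph (G \<restriction> verts H)"
      using up[OF H(1)] by (auto simp: subgraph_def)
    have "G \<restriction> verts H = H"
      using m scc[OF ind[OF H] w] up[OF H(1)] unfolding max_subgraph_def by metis
    with ind[OF H] have "strongly_connected H"
      by simp
    with m show "max_subgraph strongly_connected H"
      using scc unfolding max_subgraph_def by (auto simp: subgraph_def)
  qed
  then show ?thesis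
    by (simp add: sccs_altdef2)
qed

definition num_components :: "('a, 'b) pre_digraph \<Rightarrow> nat" where
  "num_components G = card (pre_digraph.sccs G)"

definition delete_verts :: "'a pair_pre_digraph \<Rightarrow> 'a set \<Rightarrow> ('a, 'a \<times> 'a) pre_digraph" where
  "delete_verts G S = with_proj G \<restriction> (pverts G - S)"

definition delete_edge :: "'a pair_pre_digraph \<Rightarrow> 'a \<times> 'a \<Rightarrow> 'a pair_pre_digraph" where
  "delete_edge G e =
    \<lparr> pverts = pverts G, parcs = parcs G - {(fst e, snd e), (snd e, fst e)} \<rparr>"

definition complete_graph :: "'a pair_pre_digraph \<Rightarrow> bool" where
  "complete_graph G \<longleftrightarrow> (\<exists>n. K\<^bsub>n\<^esub> (with_proj G))"

definition toughness :: "'a pair_pre_digraph \<Rightarrow> ereal" where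
  "toughness G =
    (if complete_graph G then \<infinity>
     else Min {ereal (real (card S) / real (num_components (delete_verts G S))) | S.
                 S \<subseteq> pverts G \<and> num_components (delete_verts G S) \<ge> 2})"

definition minimally_tough :: "real \<Rightarrow> 'a pair_pre_digraph \<Rightarrow> bool" where
  "minimally_tough t G \<longleftrightarrow>
    toughness G = ereal t \<and> (\<forall>e \<in> parcs G. toughness (delete_edge G e) < ereal t)"

definition claw_free :: "'a pair_pre_digraph \<Rightarrow> bool" where
  "claw_free G \<longleftrightarrow> \<not> (\<exists>H. induced_subgraph H (with_proj G) \<and> K\<^bsub>1,3\<^esub> H)"

end

theory Submission
  imports Defs "HOL-Library.Disjoint_Sets"
begin

text \<open>
  Let \<open>k = 2t\<close>. In a claw-free graph a vertex of a separator meets at most two components, so counting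
  neighbours of components shows that \<open>k\<close> is an integer, that every separating vertex set has at least
  \<open>k\<close> elements and that there are fragments, that is, sets with exactly \<open>k\<close> neighbours and a nonempty
  rest. Suppose that \<open>3 deg(v) \<ge> 5k - 2\<close> for all vertices \<open>v\<close>. By Mader's argument a fragment \<open>F\<close> of minimum
  size is disjoint from all neighbourhoods of fragments: otherwise \<open>2|F| \<le> k\<close>, and its vertices have
  degree at most \<open>3k/2 - 1\<close>.

  Let \<open>uv\<close> be an edge with \<open>u \<in> F\<close> and let \<open>S\<close> show that \<open>G - uv\<close> has toughness less than \<open>t\<close>. Counting the
  neighbours in \<open>S\<close> of the components of \<open>G - uv - S\<close> shows that \<open>u\<close> and \<open>v\<close> are two singleton components:
  otherwise \<open>S\<close> would yield a fragment having a vertex of \<open>F\<close> among its \<open>k\<close> neighbours. The same count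
  shows that \<open>u\<close> and \<open>v\<close> have nearly the same closed neighbourhood. If \<open>v \<notin> F\<close>, then some common neighbour
  \<open>w \<in> F\<close> of \<open>u\<close> and \<open>v\<close> is adjacent to a vertex \<open>c\<close> of another component \<open>Z\<close>. Comparing the closed
  neighbourhoods of \<open>v\<close>, \<open>w\<close> and \<open>c\<close>, one finds that \<open>v\<close> has too many common neighbours with \<open>Z\<close>.
\<close>

section \<open>Separations of claw-free graphs\<close>

definition nbrs :: "'a rel \<Rightarrow> 'a set \<Rightarrow> 'a set" where
  "nbrs E Z = E `` Z - Z"

text \<open>Pieces are unions of components rather than single components, so that they may be
  merged; only their number enters the toughness bound.\<close>

definition separation :: "'a set \<Rightarrow> 'a rel \<Rightarrow> 'a set \<Rightarrow> 'a set set \<Rightarrow> bool" where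
  "separation V E S P \<longleftrightarrow>
    S \<subseteq> V \<and> partition_on (V - S) P \<and> (\<forall>A\<in>P. \<forall>B\<in>P. A \<noteq> B \<longrightarrow> E `` A \<inter> B = {})"

lemma separationD:
  assumes "separation V E S P" "A \<in> P" "B \<in> P" "A \<noteq> B"
  shows "A \<inter> B = {}" "E `` A \<inter> B = {}"
  using assms by (auto simp: separation_def partition_on_def dest: disjointD)

lemma sum_card_Image_eq:
  assumes "finite P" "finite S"
  shows "(\<Sum>Z\<in>P. card (S \<inter> E `` Z)) = (\<Sum>s\<in>S. card {Z\<in>P. s \<in> E `` Z})"
proof -
  have "(\<Sum>Z\<in>P. card (S \<inter> E `` Z)) = (\<Sum>Z\<in>P. \<Sum>s\<in>S. if s \<in> E `` Z then 1 else 0)"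
    using assms by (auto intro!: sum.cong simp: sum.If_cases Int_def)
  also have "\<dots> = (\<Sum>s\<in>S. \<Sum>Z\<in>P. if s \<in> E `` Z then 1 else 0)"
    by (rule sum.swap)
  also have "\<dots> = (\<Sum>s\<in>S. card {Z\<in>P. s \<in> E `` Z})"
    using assms by (intro sum.cong) (auto simp: sum.If_cases Int_def)
  finally show ?thesis .
qed

lemma obtain_three_distinct:
  assumes "3 \<le> card A"
  obtains x y z where "x \<in> A" "y \<in> A" "z \<in> A" "x \<noteq> y" "x \<noteq> z" "y \<noteq> z"
proof -
  obtain B where "B \<subseteq> A" "card B = 3"
    using obtain_subset_with_card_n[OF assms] by blast
  then show thesis
    using that by (auto simp: card_3_iff)
qed

locale simple_graph =
  fixes V :: "'a set" and E :: "'a rel"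
  assumes finite_V [simp]: "finite V"
    and E_subset: "E \<subseteq> V \<times> V"
    and E_sym: "(x, y) \<in> E \<Longrightarrow> (y, x) \<in> E"
    and E_irrefl [simp]: "(x, x) \<notin> E"
begin

lemma Image_subset: "E `` Z \<subseteq> V"
  using E_subset by auto

lemma finite_Image [simp]: "finite (E `` Z)"
  using Image_subset finite_subset by fastforce

lemma nbrs_subset: "nbrs E Z \<subseteq> V"
  using Image_subset by (auto simp: nbrs_def)

lemma finite_nbrs [simp]: "finite (nbrs E Z)"
  by (simp add: nbrs_def)

lemma nbrs_singleton: "nbrs E {x} = E `` {x}"
  by (auto simp: nbrs_def)

lemma finite_subset_V: "Z \<subseteq> V \<Longrightarrow> finite Z"
  using finite_V by (rule rev_finite_subset)

lemma separation_nbrs: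
  assumes "Z \<subseteq> V" "Z \<noteq> {}" "Z \<union> nbrs E Z \<noteq> V"
  shows "separation V E (nbrs E Z) {Z, V - Z - nbrs E Z}" "card {Z, V - Z - nbrs E Z} = 2"
proof -
  have ne: "V - Z - nbrs E Z \<noteq> {}"
    using assms nbrs_subset[of Z] by auto
  then have "Z \<noteq> V - Z - nbrs E Z"
    using assms(2) by auto
  then show "card {Z, V - Z - nbrs E Z} = 2"
    by simp
  have "partition_on (V - nbrs E Z) {Z, V - Z - nbrs E Z}"
    using assms ne by (auto simp: partition_on_def disjoint_def nbrs_def)
  moreover have "E `` Z \<inter> (V - Z - nbrs E Z) = {}" "E `` (V - Z - nbrs E Z) \<inter> Z = {}"
    using E_sym by (auto simp: nbrs_def)
  ultimately show "separation V E (nbrs E Z) {Z, V - Z - nbrs E Z}"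
    using nbrs_subset by (auto simp: separation_def)
qed

lemma separation_props:
  assumes "separation V E' S P"
  shows "finite P" "finite S" "Z \<in> P \<Longrightarrow> Z \<subseteq> V - S" "Z \<in> P \<Longrightarrow> Z \<noteq> {}"
proof -
  have p: "partition_on (V - S) P" and S: "S \<subseteq> V"
    using assms by (auto simp: separation_def)
  show "finite P"
    by (rule finite_elements[OF _ p]) simp
  show "finite S"
    using S finite_subset_V by blast
  show "Z \<subseteq> V - S" if "Z \<in> P"
    using p that by (auto simp: partition_on_def)
  show "Z \<noteq> {}" if "Z \<in> P"
    using p that by (auto simp: partition_on_def)
qed

lemma separation_nbrs_piece:
  assumes "separation V E S P" "Z \<in> P"
  shows "nbrs E Z = S \<inter> E `` Z"
proof -
  have "E `` Z \<inter> V \<subseteq> Z \<union> S"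
    using assms unfolding separation_def partition_on_def by blast
  moreover have "Z \<inter> S = {}"
    using separation_props(3)[OF assms] by auto
  ultimately show ?thesis
    using Image_subset[of Z] by (auto simp: nbrs_def)
qed

lemma piece_closed_nbhd_neq:
  assumes "separation V E S P" "2 \<le> card P" "Z \<in> P"
  shows "Z \<union> nbrs E Z \<noteq> V"
proof -
  obtain Z' where "Z' \<in> P" "Z' \<noteq> Z"
    using assms by (metis card_le_Suc0_iff_eq card.infinite not_less_eq_eq numeral_2_eq_2 zero_le)
  then have "Z' \<subseteq> V - S" "Z' \<inter> Z = {}" "Z' \<noteq> {}" "E `` Z \<inter> Z' = {}"
    using separationD[OF assms(1)] separation_props[OF assms(1)] assms(3) by auto
  then show ?thesis
    by (auto simp: nbrs_def)
qed

end

definition fragment :: "nat \<Rightarrow> 'a set \<Rightarrow> 'a rel \<Rightarrow> 'a set \<Rightarrow> bool" where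
  "fragment k V E Z \<longleftrightarrow> Z \<subseteq> V \<and> Z \<noteq> {} \<and> Z \<union> nbrs E Z \<noteq> V \<and> card (nbrs E Z) = k"

locale claw_free_graph = simple_graph +
  assumes no_claw: "\<lbrakk>(s, a) \<in> E; (s, b) \<in> E; (s, c) \<in> E; a \<noteq> b; a \<noteq> c; b \<noteq> c\<rbrakk>
    \<Longrightarrow> (a, b) \<in> E \<or> (a, c) \<in> E \<or> (b, c) \<in> E"
begin

text \<open>Neighbours of \<open>s\<close> in three different pieces would be the leaves of a claw
  with centre \<open>s\<close>.\<close>

lemma card_pieces_le_2:
  assumes "separation V E S P"
  shows "card {Z\<in>P. s \<in> E `` Z} \<le> 2"
proof (rule ccontr)
  assume "\<not> ?thesis"
  then have "3 \<le> card {Z\<in>P. s \<in> E `` Z}"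
    by simp
  then obtain A B C where *: "A \<in> P" "B \<in> P" "C \<in> P" "s \<in> E `` A" "s \<in> E `` B" "s \<in> E `` C"
    "A \<noteq> B" "A \<noteq> C" "B \<noteq> C"
    by (rule obtain_three_distinct) auto
  then obtain a b c where abc: "a \<in> A" "b \<in> B" "c \<in> C" "(s, a) \<in> E" "(s, b) \<in> E" "(s, c) \<in> E"
    using E_sym by blast
  have "A \<inter> B = {}" "A \<inter> C = {}" "B \<inter> C = {}" "E `` A \<inter> B = {}" "E `` A \<inter> C = {}" "E `` B \<inter> C = {}"
    using * separationD[OF assms] by simp_all
  then have "a \<noteq> b" "a \<noteq> c" "b \<noteq> c" "(a, b) \<notin> E" "(a, c) \<notin> E" "(b, c) \<notin> E"
    using abc(1-3) by blast+
  then show False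
    using no_claw[OF abc(4-6)] by blast
qed

lemma sum_card_nbrs_le:
  assumes "separation V E S P"
  shows "(\<Sum>Z\<in>P. card (nbrs E Z)) \<le> 2 * card S"
proof -
  have "(\<Sum>Z\<in>P. card (nbrs E Z)) = (\<Sum>Z\<in>P. card (S \<inter> E `` Z))"
    using separation_nbrs_piece[OF assms] by simp
  also have "\<dots> = (\<Sum>s\<in>S. card {Z\<in>P. s \<in> E `` Z})"
    using separation_props[OF assms] by (intro sum_card_Image_eq)
  also have "\<dots> \<le> (\<Sum>s\<in>S. 2)"
    using card_pieces_le_2[OF assms] by (intro sum_mono)
  finally show ?thesis by simp
qed

text \<open>
  Every piece of a separation attaining the toughness has exactly \<open>2t\<close> neighbours, by counting
  the pairs of a piece and one of its neighbours in two ways.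
\<close>

lemma fragment_if_toughness_attained:
  fixes t :: real
  assumes tough: "\<And>S P. separation V E S P \<Longrightarrow> 2 \<le> card P \<Longrightarrow> t * card P \<le> card S"
    and sep: "separation V E S P" "2 \<le> card P" and eq: "real (card S) = t * card P"
  obtains k Z where "real k = 2 * t" "fragment k V E Z"
proof -
  have ge: "2 * t \<le> card (nbrs E Z)" if "Z \<in> P" for Z
  proof -
    have "Z \<subseteq> V" "Z \<noteq> {}" "Z \<union> nbrs E Z \<noteq> V"
      using separation_props[OF sep(1)] that piece_closed_nbhd_neq[OF sep that] by auto
    from tough[OF separation_nbrs(1)[OF this]] separation_nbrs(2)[OF this] show ?thesis
      by simp
  qed
  have "P \<noteq> {}"
    using sep by auto
  then obtain Z where Z: "Z \<in> P" by blast
  have "card (nbrs E Z) \<le> 2 * t"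
  proof (rule ccontr)
    assume "\<not> ?thesis"
    then have "(\<Sum>Z\<in>P. 2 * t) < (\<Sum>Z\<in>P. real (card (nbrs E Z)))"
      using ge Z separation_props(1)[OF sep(1)] by (intro sum_strict_mono_ex1) (auto simp: not_le)
    moreover have "(\<Sum>Z\<in>P. real (card (nbrs E Z))) \<le> 2 * card S"
      using sum_card_nbrs_le[OF sep(1)] by (metis of_nat_le_iff of_nat_sum)
    ultimately show False
      using eq by (simp add: algebra_simps)
  qed
  with ge[OF Z] have "real (card (nbrs E Z)) = 2 * t" by simp
  moreover have "fragment (card (nbrs E Z)) V E Z"
    using separation_props[OF sep(1)] Z piece_closed_nbhd_neq[OF sep Z] by (auto simp: fragment_def)
  ultimately show thesis using that by blast
qed

text \<open>By \<open>card_pieces_le_2\<close> a common neighbour of \<open>Z\<close> and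
  \<open>Z'\<close> is adjacent to no third piece, so moving such vertices out of \<open>S\<close>
  joins only these two pieces.\<close>

lemma separation_merge:
  assumes sep: "separation V E S P" and Z: "Z \<in> P" "Z' \<in> P" "Z \<noteq> Z'"
    and Y: "Y \<subseteq> S \<inter> E `` Z \<inter> E `` Z'"
  shows "separation V E (S - Y) (insert (Z \<union> Z' \<union> Y) (P - {Z, Z'}))"
    and "Suc (card (insert (Z \<union> Z' \<union> Y) (P - {Z, Z'}))) = card P"
proof -
  let ?M = "Z \<union> Z' \<union> Y"
  have S: "S \<subseteq> V" and U: "\<Union>P = V - S" and ne: "{} \<notin> P" and dis: "disjoint P"
    using sep by (auto simp: separation_def partition_on_def)
  have ZV: "Z \<subseteq> V - S" "Z' \<subseteq> V - S"
    using U Z by auto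
  have disM: "?M \<inter> W = {}" if "W \<in> P - {Z, Z'}" for W
    using separationD(1)[OF sep, of Z W] separationD(1)[OF sep, of Z' W] that Z Y U by auto
  have adjY: "E `` Y \<inter> W = {}" if W: "W \<in> P - {Z, Z'}" for W
  proof (rule ccontr)
    assume "E `` Y \<inter> W \<noteq> {}"
    then obtain y where y: "y \<in> Y" "y \<in> E `` W"
      using E_sym by blast
    then have "{Z, Z', W} \<subseteq> {Z\<in>P. y \<in> E `` Z}"
      using Y Z W by auto
    moreover have "card {Z, Z', W} = 3"
      unfolding card_3_iff using Z W by blast
    moreover have "finite {Z\<in>P. y \<in> E `` Z}"
      using separation_props(1)[OF sep] by simp
    ultimately show False
      using card_mono[of "{Z\<in>P. y \<in> E `` Z}" "{Z, Z', W}"] card_pieces_le_2[OF sep, of y] by auto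
  qed
  have adjM: "E `` ?M \<inter> W = {}" if W: "W \<in> P - {Z, Z'}" for W
    using separationD(2)[OF sep, of Z W] separationD(2)[OF sep, of Z' W] W Z adjY[OF W] by auto
  then have adjM': "E `` W \<inter> ?M = {}" if W: "W \<in> P - {Z, Z'}" for W
    using W E_sym by blast
  have "Z \<noteq> {}"
    using ne Z by auto
  then have "?M \<notin> P - {Z, Z'}"
    using disM by blast
  then show "Suc (card (insert ?M (P - {Z, Z'}))) = card P"
    using Z separation_props(1)[OF sep] card_Suc_Diff1[of P Z] card_Suc_Diff1[of "P - {Z}" Z']
    by (simp add: Diff_insert2[symmetric] insert_commute)
  have "\<Union>(insert ?M (P - {Z, Z'})) = V - (S - Y)"
    using U Z Y S by auto
  moreover have "disjoint (insert ?M (P - {Z, Z'}))"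
    using disM dis by (auto simp: disjoint_def)
  moreover have "{} \<notin> insert ?M (P - {Z, Z'})"
    using ne \<open>Z \<noteq> {}\<close> by auto
  ultimately have "partition_on (V - (S - Y)) (insert ?M (P - {Z, Z'}))"
    unfolding partition_on_def by (intro conjI)
  moreover have "E `` A \<inter> B = {}"
    if "A \<in> insert ?M (P - {Z, Z'})" "B \<in> insert ?M (P - {Z, Z'})" "A \<noteq> B" for A B
  proof (cases "A = ?M \<or> B = ?M")
    case False
    then show ?thesis
      using that separationD(2)[OF sep, of A B] by simp
  qed (use that adjM[of B] adjM'[of A] in blast)
  moreover have "S - Y \<subseteq> V"
    using S by blast
  ultimately show "separation V E (S - Y) (insert ?M (P - {Z, Z'}))"
    by (simp only: separation_def) blast
qed

end

section \<open>Fragments and atoms\<close>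

lemma card_Un3_le: "card (A \<union> B \<union> C) \<le> card A + card B + card C"
  by (meson add_le_mono1 card_Un_le le_trans)

text \<open>This replaces submodularity in Mader's argument: the corner \<open>X \<inter> Y\<close>
  is cut off by parts of the two cuts, to be compared with those that cut off the opposite
  corner.\<close>

lemma nbrs_Int_subset: "nbrs E (X \<inter> Y) \<subseteq> nbrs E Y \<inter> X \<union> nbrs E Y \<inter> nbrs E X \<union> nbrs E X \<inter> Y"
  by (auto simp: nbrs_def)

text \<open>Here \<open>k\<close> is twice a lower bound on the toughness; with denominators
  cleared, all counts stay in the natural numbers.\<close>

locale tough_graph = simple_graph +
  fixes k :: nat
  assumes tough: "separation V E S P \<Longrightarrow> 2 \<le> card P \<Longrightarrow> k * card P \<le> 2 * card S"
begin

lemma le_card_nbrs: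
  assumes "Z \<subseteq> V" "Z \<noteq> {}" "Z \<union> nbrs E Z \<noteq> V"
  shows "k \<le> card (nbrs E Z)"
  using tough[OF separation_nbrs(1)[OF assms]] separation_nbrs(2)[OF assms] by simp

lemma le_card_if_nbrs_subset:
  assumes "Z \<subseteq> V" "Z \<noteq> {}" "nbrs E Z \<subseteq> T" "Z \<union> T \<noteq> V" "T \<subseteq> V"
  shows "k \<le> card T"
proof -
  have "k \<le> card (nbrs E Z)"
    using assms by (intro le_card_nbrs) auto
  also have "\<dots> \<le> card T"
    using assms finite_subset_V by (intro card_mono) auto
  finally show ?thesis .
qed

lemma card_split_nbrs:
  assumes "X \<subseteq> V"
  shows "card X = card (X \<inter> Z) + card (X \<inter> nbrs E Z) + card (X \<inter> (V - Z - nbrs E Z))"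
proof -
  let ?R = "V - Z - nbrs E Z"
  have "finite X"
    using assms finite_subset_V by blast
  moreover have "X = (X \<inter> Z \<union> X \<inter> nbrs E Z) \<union> X \<inter> ?R"
    using assms by auto
  moreover have "Z \<inter> nbrs E Z = {}"
    by (auto simp: nbrs_def)
  moreover have "card ((X \<inter> Z \<union> X \<inter> nbrs E Z) \<union> X \<inter> ?R)
      = card (X \<inter> Z \<union> X \<inter> nbrs E Z) + card (X \<inter> ?R)"
    using \<open>finite X\<close> by (intro card_Un_disjoint) auto
  ultimately have "card X = card (X \<inter> Z \<union> X \<inter> nbrs E Z) + card (X \<inter> ?R)"
    by simp
  also have "card (X \<inter> Z \<union> X \<inter> nbrs E Z) = card (X \<inter> Z) + card (X \<inter> nbrs E Z)"
    using \<open>finite X\<close> \<open>Z \<inter> nbrs E Z = {}\<close> by (intro card_Un_disjoint) auto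
  finally show ?thesis .
qed

text \<open>The cut of the complement is contained in \<open>nbrs E A\<close>, which has size
  \<open>k\<close>; no cut is smaller than \<open>k\<close>, so the two coincide.\<close>

lemma fragment_complement:
  assumes "fragment k V E A"
  shows "fragment k V E (V - A - nbrs E A)" "nbrs E (V - A - nbrs E A) = nbrs E A"
proof -
  let ?B = "V - A - nbrs E A"
  have A: "A \<subseteq> V" "A \<noteq> {}" "A \<union> nbrs E A \<noteq> V" "card (nbrs E A) = k"
    using assms by (auto simp: fragment_def)
  have sub: "nbrs E ?B \<subseteq> nbrs E A"
    using E_sym Image_subset[of ?B] by (auto simp: nbrs_def)
  have "A \<inter> (?B \<union> nbrs E ?B) = {}"
    using sub by (auto simp: nbrs_def)
  then have B: "?B \<subseteq> V" "?B \<noteq> {}" "?B \<union> nbrs E ?B \<noteq> V"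
    using A nbrs_subset[of A] by auto
  show eq: "nbrs E ?B = nbrs E A"
    using le_card_nbrs[OF B] A(4) by (intro card_seteq sub) auto
  show "fragment k V E ?B"
    using B A(4) unfolding fragment_def eq by auto
qed

text \<open>
  Mader's argument for atoms: if the \<open>k\<close>-cut \<open>nbrs E A\<close> meets a fragment \<open>F\<close> of minimum size,
  then it contains \<open>F\<close>, and \<open>nbrs E F\<close> has at least \<open>card F\<close> elements on each of its two sides.
\<close>

context
  fixes F A :: "'a set"
  assumes F: "fragment k V E F" and F_min: "\<And>Z. fragment k V E Z \<Longrightarrow> card F \<le> card Z"
    and A: "fragment k V E A" and meets: "nbrs E A \<inter> F \<noteq> {}"
begin

text \<open>A non-empty corner \<open>F \<inter> A\<close> is smaller than \<open>F\<close>, hence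
  no fragment, so its cut exceeds \<open>k\<close>. Then the opposite corner has a cut smaller than
  \<open>k\<close>, or it is empty and \<open>?B\<close> is a fragment smaller than
  \<open>F\<close>.\<close>

lemma atom_Int_empty: "F \<inter> A = {}"
proof (rule ccontr)
  assume ne: "F \<inter> A \<noteq> {}"
  let ?T = "nbrs E A" and ?B = "V - A - nbrs E A" and ?N = "nbrs E F" and ?R = "V - F - nbrs E F"
  have FV: "F \<subseteq> V" "F \<union> ?N \<noteq> V" "card ?N = k" and AV: "A \<subseteq> V" "card ?T = k"
    using F A by (auto simp: fragment_def)
  have B: "fragment k V E ?B" "nbrs E ?B = ?T" and R: "fragment k V E ?R" "nbrs E ?R = ?N"
    using fragment_complement[OF A] fragment_complement[OF F] by auto
  have Tsplit: "k = card (?T \<inter> F) + card (?T \<inter> ?N) + card (?T \<inter> ?R)"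
    using card_split_nbrs[OF nbrs_subset[of A], of F] AV by simp
  have Nsplit: "k = card (?N \<inter> A) + card (?N \<inter> ?T) + card (?N \<inter> ?B)"
    using card_split_nbrs[OF nbrs_subset[of F], of A] FV by simp
  have "nbrs E (F \<inter> A) \<subseteq> ?T \<inter> F \<union> ?T \<inter> ?N \<union> ?N \<inter> A"
    by (rule nbrs_Int_subset)
  then have le: "card (nbrs E (F \<inter> A)) \<le> card (?T \<inter> F) + card (?T \<inter> ?N) + card (?N \<inter> A)"
    by (intro order_trans[OF card_mono card_Un3_le[of "?T \<inter> F" "?T \<inter> ?N" "?N \<inter> A"]]) auto
  have FA: "F \<inter> A \<subseteq> V" "F \<inter> A \<union> nbrs E (F \<inter> A) \<noteq> V"
  proof -
    have "F \<inter> A \<union> nbrs E (F \<inter> A) \<subseteq> F \<union> ?N"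
      by (auto simp: nbrs_def)
    moreover have "F \<union> ?N \<subset> V"
      using FV nbrs_subset[of F] by auto
    ultimately show "F \<inter> A \<union> nbrs E (F \<inter> A) \<noteq> V"
      by auto
  qed (use FV in auto)
  have "card (F \<inter> A) < card F"
    using meets FV finite_subset_V by (intro psubset_card_mono) (auto simp: nbrs_def)
  then have "card (nbrs E (F \<inter> A)) \<noteq> k"
    using F_min[of "F \<inter> A"] FA ne by (auto simp: fragment_def)
  then have gt: "k < card (nbrs E (F \<inter> A))"
    using le_card_nbrs[OF FA(1) ne FA(2)] by simp
  have b: "card (?N \<inter> ?B) < card (?T \<inter> F)"
    using le gt Nsplit by (simp add: Int_commute)
  show False
  proof (cases "?R \<inter> ?B = {}")
    case True
    have "?B = ?B \<inter> F \<union> ?B \<inter> ?N"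
      using True by auto
    then have "card ?B \<le> card (?B \<inter> F) + card (?B \<inter> ?N)"
      by (metis card_Un_le)
    moreover have "card ?B \<ge> card F"
      using F_min[OF B(1)] .
    moreover have "card F = card (F \<inter> A) + card (F \<inter> ?T) + card (F \<inter> ?B)"
      using card_split_nbrs[OF FV(1)] .
    ultimately show False
      using b by (simp add: Int_commute)
  next
    case False
    have "nbrs E (?R \<inter> ?B) \<subseteq> ?T \<inter> ?R \<union> ?T \<inter> ?N \<union> ?N \<inter> ?B" (is "_ \<subseteq> ?Q")
      using nbrs_Int_subset[of E ?R ?B] unfolding B(2) R(2) .
    moreover have "(F \<inter> A) \<inter> (?R \<inter> ?B \<union> ?Q) = {}"
      by (auto simp: nbrs_def)
    then have "?R \<inter> ?B \<union> ?Q \<noteq> V"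
      using ne FV(1) by auto
    ultimately have "k \<le> card ?Q"
      using False nbrs_subset by (intro le_card_if_nbrs_subset[of "?R \<inter> ?B"]) auto
    also have "\<dots> \<le> card (?T \<inter> ?R) + card (?T \<inter> ?N) + card (?N \<inter> ?B)"
      by (rule card_Un3_le)
    finally show False
      using b Tsplit by (simp add: Int_commute)
  qed
qed

end

context
  fixes F :: "'a set"
  assumes F: "fragment k V E F" and F_min: "\<And>Z. fragment k V E Z \<Longrightarrow> card F \<le> card Z"
begin

text \<open>Either \<open>A\<close> lies in the cut of \<open>F\<close> and minimality of
  \<open>F\<close> applies, or \<open>A\<close> meets the far side of \<open>F\<close>. That corner
  has a cut of at least \<open>k\<close> vertices, and splitting \<open>nbrs E A\<close> along
  \<open>F\<close> gives the claim.\<close>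

lemma card_atom_le_nbrs_Int:
  assumes A: "fragment k V E A" and sub: "F \<subseteq> nbrs E A"
  shows "card F \<le> card (nbrs E F \<inter> A)"
proof (cases "A \<subseteq> nbrs E F")
  case True
  then show ?thesis
    using F_min[OF A] by (simp add: Int_absorb1)
next
  case False
  let ?T = "nbrs E A" and ?N = "nbrs E F" and ?R = "V - F - nbrs E F"
  have FV: "F \<subseteq> V" "F \<noteq> {}" and AV: "A \<subseteq> V" "card ?T = k"
    using F A by (auto simp: fragment_def)
  have R: "nbrs E ?R = ?N"
    using fragment_complement[OF F] by auto
  have "?R \<inter> A \<noteq> {}"
    using False sub AV by (auto simp: nbrs_def)
  moreover have "nbrs E (?R \<inter> A) \<subseteq> ?T \<inter> ?R \<union> ?T \<inter> ?N \<union> ?N \<inter> A" (is "_ \<subseteq> ?Q")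
    using nbrs_Int_subset[of E ?R A] unfolding R .
  moreover have "F \<inter> (?R \<inter> A \<union> ?Q) = {}"
    by (auto simp: nbrs_def)
  then have "?R \<inter> A \<union> ?Q \<noteq> V"
    using FV by auto
  ultimately have "k \<le> card ?Q"
    using nbrs_subset by (intro le_card_if_nbrs_subset[of "?R \<inter> A"]) auto
  also have "\<dots> \<le> card (?T \<inter> ?R) + card (?T \<inter> ?N) + card (?N \<inter> A)"
    by (rule card_Un3_le)
  finally have "card (?T \<inter> F) \<le> card (?N \<inter> A)"
    using card_split_nbrs[OF nbrs_subset[of A], of F] AV(2) by simp
  then show ?thesis
    using sub by (simp add: Int_absorb1)
qed

lemma card_atom_le_if_cut_meets:
  assumes A: "fragment k V E A" and meets: "nbrs E A \<inter> F \<noteq> {}"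
  shows "2 * card F \<le> k"
proof -
  let ?B = "V - A - nbrs E A"
  have B: "fragment k V E ?B" "nbrs E ?B = nbrs E A"
    using fragment_complement[OF A] by auto
  have FV: "F \<subseteq> V" "card (nbrs E F) = k"
    using F by (auto simp: fragment_def)
  have "F \<inter> A = {}" "F \<inter> ?B = {}"
    using atom_Int_empty[OF F F_min A meets] atom_Int_empty[OF F F_min B(1)] B(2) meets by auto
  then have "F \<subseteq> nbrs E A"
    using FV by auto
  then have "card F \<le> card (nbrs E F \<inter> A)" "card F \<le> card (nbrs E F \<inter> ?B)"
    using card_atom_le_nbrs_Int[OF A] card_atom_le_nbrs_Int[OF B(1)] B(2) by auto
  then show ?thesis
    using card_split_nbrs[OF nbrs_subset[of F], of A] FV(2) by simp
qed

end

end

section \<open>Separations of a graph minus an edge\<close>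

text \<open>The pieces are separated only in the graph without \<open>uv\<close>, while claws are
  excluded in the graph with it. So \<open>uv\<close> is the only edge between different
  pieces.\<close>

locale edge_separation = claw_free_graph +
  fixes u v :: 'a and S :: "'a set" and P :: "'a set set" and A B :: "'a set"
  assumes uv: "(u, v) \<in> E"
    and sep: "separation V (E - {(u, v), (v, u)}) S P"
    and A: "A \<in> P" and B: "B \<in> P" and A_neq_B: "A \<noteq> B" and u_A: "u \<in> A" and v_B: "v \<in> B"
begin

lemma swap: "edge_separation V E v u S P B A"
  using uv sep A B A_neq_B u_A v_B E_sym by unfold_locales (auto simp: insert_commute)

lemma cross:
  assumes "Z \<in> P" "W \<in> P" "Z \<noteq> W" "a \<in> Z" "b \<in> W" "(a, b) \<in> E"
  shows "a = u \<and> b = v \<or> a = v \<and> b = u"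
  using separationD(2)[OF sep assms(1-3)] assms(4-6) by auto

lemma piece_unique: "Z \<in> P \<Longrightarrow> W \<in> P \<Longrightarrow> x \<in> Z \<Longrightarrow> x \<in> W \<Longrightarrow> Z = W"
  using separationD(1)[OF sep] by blast

lemma S_disjoint: "Z \<in> P \<Longrightarrow> S \<inter> Z = {}"
  using separation_props(3)[OF sep] by auto

lemma S_subset: "S \<subseteq> V"
  using sep by (auto simp: separation_def)

lemma in_piece_or_S: "x \<in> V \<Longrightarrow> x \<in> S \<or> (\<exists>Z\<in>P. x \<in> Z)"
  using sep unfolding separation_def partition_on_def by blast

text \<open>These turn out to be the only vertices of \<open>S\<close> that can be adjacent to more
  than two pieces.\<close>

definition X :: "'a set" where
  "X = {s\<in>S. (s, u) \<in> E \<and> (s, v) \<in> E \<and> s \<in> E `` (\<Union>(P - {A, B}))}"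

lemma X_subset: "X \<subseteq> S"
  by (auto simp: X_def)

text \<open>Three neighbours of \<open>s\<close> in different pieces must span an edge, which can
  only be \<open>uv\<close>.\<close>

lemma three_pieces:
  assumes "Z1 \<in> P" "Z2 \<in> P" "Z3 \<in> P" "Z1 \<noteq> Z2" "Z1 \<noteq> Z3" "Z2 \<noteq> Z3"
    and "s \<in> E `` Z1" "s \<in> E `` Z2" "s \<in> E `` Z3"
  shows "A \<in> {Z1, Z2, Z3}" "B \<in> {Z1, Z2, Z3}" "(s, u) \<in> E" "(s, v) \<in> E"
proof -
  obtain a b c where abc: "a \<in> Z1" "b \<in> Z2" "c \<in> Z3" "(s, a) \<in> E" "(s, b) \<in> E" "(s, c) \<in> E"
    using assms(7-9) E_sym by blast
  have "a \<noteq> b" "a \<noteq> c" "b \<noteq> c"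
    using abc(1-3) assms(1-6) piece_unique by blast+
  with no_claw[OF abc(4-6)] have "(a, b) \<in> E \<or> (a, c) \<in> E \<or> (b, c) \<in> E"
    by blast
  then have "{u, v} \<subseteq> {a, b, c}"
    using cross[OF assms(1,2,4) abc(1,2)] cross[OF assms(1,3,5) abc(1,3)]
      cross[OF assms(2,3,6) abc(2,3)] by blast
  then have "u \<in> {a, b, c}" "v \<in> {a, b, c}"
    by auto
  then show "(s, u) \<in> E" "(s, v) \<in> E" "A \<in> {Z1, Z2, Z3}" "B \<in> {Z1, Z2, Z3}"
    using abc piece_unique[OF A _ u_A] piece_unique[OF B _ v_B] assms(1-3) by blast+
qed

lemma card_pieces_le:
  assumes "s \<in> S"
  shows "card {Z\<in>P. s \<in> E `` Z} \<le> 2 + (if s \<in> X then 1 else 0)"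
proof (rule ccontr)
  let ?Q = "{Z\<in>P. s \<in> E `` Z}"
  assume c: "\<not> ?thesis"
  have fin: "finite ?Q"
    using separation_props(1)[OF sep] by simp
  show False
  proof (cases "s \<in> X")
    case True
    \<comment> \<open>Four pieces adjacent to \<open>s\<close> would leave three without
      \<open>A\<close>, but \<open>three_pieces\<close> puts \<open>A\<close> among any
      three.\<close>
    then have "3 \<le> card (?Q - {A})"
      using c fin by (auto simp: card_Diff_singleton_if)
    then obtain Z1 Z2 Z3 where "Z1 \<in> ?Q - {A}" "Z2 \<in> ?Q - {A}" "Z3 \<in> ?Q - {A}"
      "Z1 \<noteq> Z2" "Z1 \<noteq> Z3" "Z2 \<noteq> Z3"
      by (rule obtain_three_distinct)
    then show False
      using three_pieces(1)[of Z1 Z2 Z3 s] by auto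
  next
    case False
    then have "3 \<le> card ?Q"
      using c by simp
    then obtain Z1 Z2 Z3 where Z: "Z1 \<in> ?Q" "Z2 \<in> ?Q" "Z3 \<in> ?Q" "Z1 \<noteq> Z2" "Z1 \<noteq> Z3" "Z2 \<noteq> Z3"
      by (rule obtain_three_distinct)
    have tp: "A \<in> {Z1, Z2, Z3}" "B \<in> {Z1, Z2, Z3}" "(s, u) \<in> E" "(s, v) \<in> E"
      using three_pieces[of Z1 Z2 Z3 s] Z by auto
    then have "\<exists>Z\<in>{Z1, Z2, Z3}. Z \<noteq> A \<and> Z \<noteq> B"
      using Z(4-6) by auto
    then have "s \<in> E `` (\<Union>(P - {A, B}))"
      using Z(1-3) by blast
    then show False
      using False assms tp by (auto simp: X_def)
  qed
qed

lemma sum_card_le: "(\<Sum>Z\<in>P. card (S \<inter> E `` Z)) \<le> 2 * card S + card X"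
proof -
  have fin: "finite P" "finite S"
    using separation_props[OF sep] by auto
  have "(\<Sum>Z\<in>P. card (S \<inter> E `` Z)) = (\<Sum>s\<in>S. card {Z\<in>P. s \<in> E `` Z})"
    using fin by (rule sum_card_Image_eq)
  also have "\<dots> \<le> (\<Sum>s\<in>S. 2 + (if s \<in> X then 1 else 0))"
    using card_pieces_le by (intro sum_mono)
  also have "\<dots> = 2 * card S + card X"
    using fin X_subset unfolding sum.distrib by (simp add: sum.If_cases Int_absorb1)
  finally show ?thesis .
qed

text \<open>Otherwise \<open>a\<close>, \<open>v\<close> and a neighbour of \<open>s\<close> in a
  third piece would form a claw.\<close>

lemma X_nbr_in_A:
  assumes "s \<in> X" "a \<in> A" "(s, a) \<in> E"
  shows "a = u"
proof (rule ccontr)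
  assume "a \<noteq> u"
  obtain C c where C: "C \<in> P" "C \<noteq> A" "C \<noteq> B" "c \<in> C" "(s, c) \<in> E" and "(s, v) \<in> E"
    using assms(1) E_sym by (auto simp: X_def)
  have "a \<noteq> v" "a \<noteq> c" "v \<noteq> c"
    using piece_unique A B C A_neq_B assms(2) v_B by blast+
  then have "(a, v) \<in> E \<or> (a, c) \<in> E \<or> (v, c) \<in> E"
    using no_claw[OF assms(3) \<open>(s, v) \<in> E\<close> C(5)] by blast
  then show False
    using cross[OF A B A_neq_B assms(2) v_B] cross[OF A C(1) C(2)[symmetric] assms(2) C(4)]
      cross[OF B C(1) C(3)[symmetric] v_B C(4)] \<open>a \<noteq> u\<close> \<open>a \<noteq> v\<close> piece_unique[OF A C(1) u_A] C(2,4)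
    by blast
qed

lemma nbrs_A: "nbrs E A = insert v (S \<inter> E `` A)"
proof
  show "nbrs E A \<subseteq> insert v (S \<inter> E `` A)"
  proof
    fix y assume "y \<in> nbrs E A"
    then obtain a where y: "a \<in> A" "(a, y) \<in> E" "y \<notin> A"
      by (auto simp: nbrs_def)
    then have "y \<in> V"
      using E_subset by auto
    show "y \<in> insert v (S \<inter> E `` A)"
    proof (cases "y \<in> S")
      case False
      then obtain Z where "Z \<in> P" "y \<in> Z"
        using in_piece_or_S \<open>y \<in> V\<close> by blast
      then show ?thesis
        using cross[OF A _ _ y(1) _ y(2), of Z] y u_A by auto
    qed (use y in auto)
  qed
  show "insert v (S \<inter> E `` A) \<subseteq> nbrs E A"
    using uv u_A v_B piece_unique[OF A B] A_neq_B S_disjoint[OF A] by (auto simp: nbrs_def)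
qed

lemma card_nbrs_A: "card (nbrs E A) = Suc (card (S \<inter> E `` A))"
  using S_disjoint[OF B] v_B unfolding nbrs_A by (subst card_insert_disjoint) auto

text \<open>Dropping \<open>u\<close> from \<open>A\<close> adds only \<open>u\<close> to the cut
  and frees \<open>v\<close> and all of \<open>X\<close>. This offsets the term
  \<open>card X\<close> in \<open>sum_card_le\<close>.\<close>

lemma nbrs_A_minus: "nbrs E (A - {u}) \<subseteq> insert u (S \<inter> E `` A - X)"
proof
  fix y assume "y \<in> nbrs E (A - {u})"
  then obtain a where y: "a \<in> A" "a \<noteq> u" "(a, y) \<in> E" "y \<notin> A - {u}"
    by (auto simp: nbrs_def)
  show "y \<in> insert u (S \<inter> E `` A - X)"
  proof (cases "y = u")
    case False
    then have "y \<in> nbrs E A"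
      using y by (auto simp: nbrs_def)
    moreover have "y \<noteq> v"
      using cross[OF A B A_neq_B y(1) v_B] y u_A v_B piece_unique[OF A B] A_neq_B by blast
    moreover have "y \<notin> X"
      using X_nbr_in_A[OF _ y(1) E_sym[OF y(3)]] y(2) by blast
    ultimately show ?thesis
      by (auto simp: nbrs_A)
  qed simp
qed

lemma nbrs_other:
  assumes "Z \<in> P - {A, B}"
  shows "nbrs E Z = S \<inter> E `` Z"
proof -
  have "E `` Z \<inter> W = {}" if "W \<in> P" "W \<noteq> Z" for W
    using cross[of Z W] that assms piece_unique[OF A _ u_A, of Z] piece_unique[OF B _ v_B, of Z] by blast
  then have "E `` Z \<subseteq> Z \<union> S"
    using in_piece_or_S Image_subset[of Z] by blast
  then show ?thesis
    using S_disjoint[of Z] assms by (auto simp: nbrs_def)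
qed

end

section \<open>Graphs of large degree\<close>

text \<open>A counterexample with \<open>k = 2t\<close>: \<open>large_degree\<close> is the integral
  form of exceeding the claimed bound at every vertex.\<close>

locale large_degree_graph = claw_free_graph + tough_graph +
  assumes minimal: "(u, v) \<in> E \<Longrightarrow> \<exists>S P. separation V (E - {(u, v), (v, u)}) S P \<and>
      2 \<le> card P \<and> 2 * card S < k * card P"
    and large_degree: "v \<in> V \<Longrightarrow> 5 * k \<le> 3 * card (E `` {v}) + 2"
    and k_ge_4: "4 \<le> k"
begin

text \<open>Merging \<open>Z\<close> and \<open>Z'\<close> along all their common neighbours still
  leaves two pieces, so toughness applies to the smaller separator.\<close>

lemma card_common_nbrs_le:
  assumes sep: "separation V E S P" and "3 \<le> card P" and Z: "Z \<in> P" "Z' \<in> P" "Z \<noteq> Z'"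
  shows "k * (card P - 1) + 2 * card (S \<inter> E `` Z \<inter> E `` Z') \<le> 2 * card S"
proof -
  let ?Y = "S \<inter> E `` Z \<inter> E `` Z'" and ?P = "insert (Z \<union> Z' \<union> S \<inter> E `` Z \<inter> E `` Z') (P - {Z, Z'})"
  have "separation V E (S - ?Y) ?P" and c: "Suc (card ?P) = card P"
    using separation_merge[OF sep Z order_refl] by auto
  then have "k * card ?P \<le> 2 * card (S - ?Y)"
    using assms(2) by (intro tough) auto
  moreover have "card (S - ?Y) = card S - card ?Y" "card ?Y \<le> card S"
    using separation_props(2)[OF sep] by (auto intro!: card_Diff_subset card_mono)
  ultimately show ?thesis
    using c by (metis (no_types, lifting) add.commute add_le_imp_le_diff diff_Suc_1 diff_mult_distrib2
        le_diff_conv2 mult_le_mono2)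
qed

lemma obtain_fragment_avoiding_cuts:
  assumes "fragment k V E Z"
  obtains F where "fragment k V E F" "\<And>A. fragment k V E A \<Longrightarrow> nbrs E A \<inter> F = {}"
proof -
  obtain F where F: "fragment k V E F" and F_min: "\<And>Z. fragment k V E Z \<Longrightarrow> card F \<le> card Z"
    using assms exists_least_iff[of "\<lambda>n. \<exists>Z. fragment k V E Z \<and> card Z = n"] by (metis not_le)
  have "nbrs E A \<inter> F = {}" if A: "fragment k V E A" for A
  proof (rule ccontr)
    assume "nbrs E A \<inter> F \<noteq> {}"
    then have le: "2 * card F \<le> k"
      using card_atom_le_if_cut_meets[OF F F_min A] by blast
    obtain u where u: "u \<in> F"
      using F by (auto simp: fragment_def)
    have fin: "finite F" "u \<in> V"
      using F u finite_subset_V by (auto simp: fragment_def)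
    have "E `` {u} \<subseteq> (F - {u}) \<union> nbrs E F"
      using u by (auto simp: nbrs_def)
    then have "card (E `` {u}) \<le> card (F - {u}) + card (nbrs E F)"
      using fin by (meson card_Un_le card_mono finite_Diff finite_UnI finite_nbrs le_trans)
    also have "\<dots> = card F - 1 + k"
      using u F by (simp add: fragment_def)
    finally show False
      using large_degree[OF fin(2)] le k_ge_4 by linarith
  qed
  then show thesis
    using that F by blast
qed

end

section \<open>Edges at a fragment that is disjoint from the cuts of all fragments\<close>

locale avoiding_fragment = large_degree_graph +
  fixes F :: "'a set"
  assumes F: "fragment k V E F" and F_avoids: "fragment k V E A \<Longrightarrow> nbrs E A \<inter> F = {}"
begin

text \<open>If \<open>T\<close> had only \<open>k\<close> elements, it would be the whole cut of
  \<open>Z\<close>, and \<open>Z\<close> a fragment whose cut meets \<open>F\<close>. The gain of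
  one serves for bounding sets that contain \<open>u\<close>.\<close>

lemma less_card_if_nbrs_subset:
  assumes "Z \<subseteq> V" "Z \<noteq> {}" "nbrs E Z \<subseteq> T" "Z \<union> T \<noteq> V" "T \<subseteq> V" "T \<inter> F \<noteq> {}"
  shows "k < card T"
proof (rule ccontr)
  have Z: "Z \<union> nbrs E Z \<noteq> V" "finite T"
    using assms finite_subset_V by auto
  assume "\<not> k < card T"
  then have "nbrs E Z = T"
    using le_card_nbrs[OF assms(1,2) Z(1)] Z(2) assms(3) by (intro card_seteq) auto
  moreover have "card T = k"
    using le_card_if_nbrs_subset[OF assms(1-5)] \<open>\<not> k < card T\<close> by simp
  ultimately have "fragment k V E Z"
    using assms Z by (auto simp: fragment_def)
  then show False
    using F_avoids \<open>nbrs E Z = T\<close> assms(6) by blast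
qed

text \<open>Counting forces the pieces of \<open>u\<close> and \<open>v\<close> to be singletons.
  Restoring the edge joins them to \<open>{u, v}\<close> and gives a separation of the graph itself,
  with one piece fewer than the bound \<open>card C + 2\<close> counts.\<close>

lemma obtain_critical_separation:
  assumes u: "u \<in> F" and uv: "(u, v) \<in> E"
  obtains S C where "separation V E S (insert {u, v} C)" "{u, v} \<notin> C" "C \<noteq> {}"
    "2 * card S < k * (card C + 2)"
    "(\<Sum>Z\<in>C. card (nbrs E Z)) + card (E `` {u}) + card (E `` {v})
      \<le> 2 * card S + card {s\<in>S. (s, u) \<in> E \<and> (s, v) \<in> E \<and> s \<in> E `` \<Union>C} + 2"
proof -
  obtain S P where sep: "separation V (E - {(u, v), (v, u)}) S P" and "2 \<le> card P"
    and lt: "2 * card S < k * card P"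
    using minimal[OF uv] by blast
  \<comment> \<open>Otherwise \<open>uv\<close> joins no two pieces, and \<open>S\<close> violates
    toughness in the graph itself.\<close>
  have "\<exists>A\<in>P. \<exists>B\<in>P. A \<noteq> B \<and> u \<in> A \<and> v \<in> B"
  proof (rule ccontr)
    assume no: "\<not> ?thesis"
    have "E `` A \<inter> B = {}" if "A \<in> P" "B \<in> P" "A \<noteq> B" for A B
      using separationD(2)[OF sep that] no that by blast
    then have "separation V E S P"
      using sep by (simp add: separation_def)
    then show False
      using tough[of S P] \<open>2 \<le> card P\<close> lt by simp
  qed
  then obtain A B where "A \<in> P" "B \<in> P" "A \<noteq> B" "u \<in> A" "v \<in> B"
    by blast
  then interpret es: edge_separation V E u v S P A B
    using uv sep by unfold_locales
  interpret es': edge_separation V E v u S P B A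
    by (rule es.swap)
  define C where "C = P - {A, B}"
  have X_eq: "es.X = {s\<in>S. (s, u) \<in> E \<and> (s, v) \<in> E \<and> s \<in> E `` \<Union>C}"
    by (auto simp: es.X_def C_def)
  have X'_eq: "es'.X = es.X"
    by (auto simp: es.X_def es'.X_def)
  have fin: "finite P" "finite S" "finite C" "finite es.X"
    using separation_props[OF sep] es.X_subset finite_subset by (auto simp: C_def)
  have P_eq: "P = insert A (insert B C)" "A \<notin> insert B C" "B \<notin> C"
    using es.A es.B es.A_neq_B by (auto simp: C_def)
  then have card_P: "card P = card C + 2"
    using fin by simp
  have pieces: "A \<subseteq> V" "B \<subseteq> V" "v \<notin> A" "u \<notin> B" "u \<notin> S" "v \<notin> S" "A \<inter> B = {}" "S \<inter> A = {}" "S \<inter> B = {}"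
    using separation_props(3)[OF sep] es.A es.B es.u_A es.v_B separationD(1)[OF sep es.A es.B es.A_neq_B]
    by auto
  have uvV: "u \<in> V" "v \<in> V"
    using uv E_subset by auto
  have nbrs_C: "nbrs E Z = S \<inter> E `` Z" "k \<le> card (nbrs E Z)" if "Z \<in> C" for Z
  proof -
    show eq: "nbrs E Z = S \<inter> E `` Z"
      using es.nbrs_other that by (simp add: C_def)
    have "Z \<in> P" "u \<notin> Z"
      using that es.piece_unique[OF es.A _ es.u_A] by (auto simp: C_def)
    then show "k \<le> card (nbrs E Z)"
      using separation_props(3,4)[OF sep] pieces(5) uvV(1) eq by (intro le_card_nbrs) auto
  qed
  have "k * card C \<le> (\<Sum>Z\<in>C. card (nbrs E Z))"
    using sum_mono[of C "\<lambda>_. k" "\<lambda>Z. card (nbrs E Z)"] nbrs_C(2) by (simp add: mult.commute)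
  moreover have "(\<Sum>Z\<in>P. card (S \<inter> E `` Z))
      = card (S \<inter> E `` A) + card (S \<inter> E `` B) + (\<Sum>Z\<in>C. card (nbrs E Z))"
    using P_eq fin nbrs_C(1) by simp
  ultimately have count: "k * card C + card (S \<inter> E `` A) + card (S \<inter> E `` B) \<le> 2 * card S + card es.X"
    and count': "(\<Sum>Z\<in>C. card (nbrs E Z)) + card (S \<inter> E `` A) + card (S \<inter> E `` B)
      \<le> 2 * card S + card es.X"
    using es.sum_card_le by linarith+
  have lt': "2 * card S < k * card C + 2 * k"
    using lt card_P by (simp add: algebra_simps)
  have X_sub: "es.X \<subseteq> S \<inter> E `` A" "es.X \<subseteq> S \<inter> E `` B"
    using es.u_A es.v_B E_sym by (auto simp: X_eq)
  have deg: "k + 2 \<le> card (E `` {x})" if "x \<in> V" for x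
    using large_degree[OF that] k_ge_4 by simp
  \<comment> \<open>Otherwise \<open>less_card_if_nbrs_subset\<close> applies to
    \<open>A - {u}\<close> and to \<open>B\<close>, as both bounding sets contain \<open>u\<close>.
    Then \<open>S\<close> has at least \<open>k + card es.X\<close> neighbours of \<open>A\<close>
    and \<open>k\<close> of \<open>B\<close>, against \<open>count\<close> and
    \<open>lt'\<close>.\<close>
  have A_eq: "A = {u}"
  proof (rule ccontr)
    assume "A \<noteq> {u}"
    then obtain a where a: "a \<in> A" "a \<noteq> u"
      using es.u_A by blast
    have "k < card (insert u (S \<inter> E `` A - es.X))"
      using a pieces uvV u es.v_B es.S_subset
      by (intro less_card_if_nbrs_subset[OF _ _ es.nbrs_A_minus]) auto
    then have "k \<le> card (S \<inter> E `` A - es.X)"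
      using fin pieces by simp
    then have "k + card es.X \<le> card (S \<inter> E `` A)"
      using X_sub(1) fin by (simp add: card_Diff_subset card_mono le_diff_conv2)
    moreover have "k < card (nbrs E B)"
    proof (intro less_card_if_nbrs_subset[OF _ _ order_refl])
      have "a \<notin> B \<union> nbrs E B" "a \<in> V"
        using a pieces unfolding es'.nbrs_A by auto
      then show "B \<union> nbrs E B \<noteq> V" by blast
      show "nbrs E B \<inter> F \<noteq> {}"
        using u unfolding es'.nbrs_A by auto
    qed (use pieces es.v_B nbrs_subset in auto)
    ultimately show False
      using count lt' es'.card_nbrs_A by simp
  qed
  have deg_u: "card (E `` {u}) = Suc (card (S \<inter> E `` A))"
    using es.card_nbrs_A by (simp add: A_eq nbrs_singleton)
  \<comment> \<open>Since \<open>v\<close> may lie outside \<open>F\<close>, the cut bound is one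
    weaker here; the missing unit comes from the degree of \<open>u\<close>, now that
    \<open>A = {u}\<close>.\<close>
  have B_eq: "B = {v}"
  proof (rule ccontr)
    assume "B \<noteq> {v}"
    then obtain b where b: "b \<in> B" "b \<noteq> v"
      using es.v_B by blast
    have "k \<le> card (insert v (S \<inter> E `` B - es'.X))"
      using b pieces uvV es.u_A es.S_subset
      by (intro le_card_if_nbrs_subset[OF _ _ es'.nbrs_A_minus]) auto
    then have "k \<le> Suc (card (S \<inter> E `` B - es.X))"
      using fin pieces by (simp add: X'_eq)
    then have "k + card es.X \<le> Suc (card (S \<inter> E `` B))"
      using X_sub(2) fin card_mono[of "S \<inter> E `` B" es.X] by (simp add: card_Diff_subset)
    then show False
      using count lt' deg_u deg[OF uvV(1)] by simp
  qed
  have deg_v: "card (E `` {v}) = Suc (card (S \<inter> E `` B))"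
    using es'.card_nbrs_A by (simp add: B_eq nbrs_singleton)
  \<comment> \<open>Without further pieces \<open>card S < k\<close>, but \<open>S\<close> contains
    more than \<open>k\<close> neighbours of \<open>u\<close>.\<close>
  have "C \<noteq> {}"
  proof
    assume "C = {}"
    moreover have "card (S \<inter> E `` A) \<le> card S"
      using fin by (intro card_mono) auto
    ultimately show False
      using lt' deg_u deg[OF uvV(1)] by simp
  qed
  moreover have "{u, v} \<notin> C"
    using es.piece_unique[OF es.A _ es.u_A, of "{u, v}"] A_eq uv by (auto simp: C_def)
  moreover have "separation V E S (insert {u, v} C)"
  proof -
    have U: "\<Union>P = V - S" and ne: "{} \<notin> P"
      using sep by (auto simp: separation_def partition_on_def)
    have CP: "W \<in> P" "u \<notin> W" "v \<notin> W" "A \<noteq> W" "B \<noteq> W" if "W \<in> C" for W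
      using that es.piece_unique[OF es.A _ es.u_A] es.piece_unique[OF es.B _ es.v_B]
      by (auto simp: C_def)
    have "\<Union>(insert {u, v} C) = V - S"
      unfolding U[symmetric] P_eq(1) A_eq B_eq by auto
    moreover have "disjoint (insert {u, v} C)"
      using CP separationD(1)[OF sep] by (auto simp: disjoint_def)
    moreover have "{} \<notin> insert {u, v} C"
      using ne by (auto simp: C_def)
    ultimately have "partition_on (V - S) (insert {u, v} C)"
      unfolding partition_on_def by (intro conjI)
    moreover have uv_C: "E `` {u, v} \<inter> W = {}" if "W \<in> C" for W
      using CP[OF that] es.cross[OF es.A _ _ es.u_A, of W] es.cross[OF es.B _ _ es.v_B, of W] by auto
    have C_uv: "E `` W \<inter> {u, v} = {}" if "W \<in> C" for W
      using uv_C[OF that] E_sym by blast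
    have C_C: "E `` Z \<inter> W = {}" if "Z \<in> C" "W \<in> C" "Z \<noteq> W" for Z W
      using CP[OF that(1)] CP[OF that(2)] es.cross[of Z W] that(3) by auto
    have "E `` Z \<inter> W = {}" if "Z \<in> insert {u, v} C" "W \<in> insert {u, v} C" "Z \<noteq> W" for Z W
      using that(1,2)
    proof (elim insertE)
      assume "Z = {u, v}" "W = {u, v}"
      then show ?thesis using that(3) by simp
    next
      assume "Z = {u, v}" "W \<in> C"
      then show ?thesis using uv_C by simp
    next
      assume "Z \<in> C" "W = {u, v}"
      then show ?thesis using C_uv by simp
    next
      assume "Z \<in> C" "W \<in> C"
      then show ?thesis using C_C that(3) by blast
    qed
    ultimately show ?thesis
      using es.S_subset unfolding separation_def by (intro conjI ballI impI)
  qed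
  moreover have "2 * card S < k * (card C + 2)"
    using lt' by (simp add: algebra_simps)
  moreover have "(\<Sum>Z\<in>C. card (nbrs E Z)) + card (E `` {u}) + card (E `` {v})
      \<le> 2 * card S + card {s\<in>S. (s, u) \<in> E \<and> (s, v) \<in> E \<and> s \<in> E `` \<Union>C} + 2"
    using count' deg_u deg_v by (simp add: X_eq)
  ultimately show thesis
    using that by blast
qed

text \<open>
  The slack \<open>j\<close> is the total excess of the neighbourhoods of the pieces over \<open>k\<close>. A single unit of it
  is what makes the bound sharp enough in the end.
\<close>

lemma private_nbrs_le:
  assumes uv: "(u, v) \<in> E" and sep: "separation V E S (insert {u, v} C)" "{u, v} \<notin> C"
    and lt: "2 * card S < k * (card C + 2)"
    and count: "(\<Sum>Z\<in>C. card (nbrs E Z)) + card (E `` {u}) + card (E `` {v})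
      \<le> 2 * card S + card {s\<in>S. (s, u) \<in> E \<and> (s, v) \<in> E \<and> s \<in> E `` \<Union>C} + 2"
    and le: "k * card C + j \<le> (\<Sum>Z\<in>C. card (nbrs E Z))"
  shows "3 * (card (E `` {v} - insert u (E `` {u})) + j) \<le> k + 2"
proof -
  let ?X = "{s\<in>S. (s, u) \<in> E \<and> (s, v) \<in> E \<and> s \<in> E `` \<Union>C}"
  let ?D = "E `` {v} - insert u (E `` {u})"
  have uvV: "u \<in> V" "v \<in> V"
    using uv E_subset by auto
  \<comment> \<open>These are disjoint sets of neighbours of \<open>v\<close>, so in
    \<open>count\<close> the degree of \<open>v\<close> absorbs \<open>card ?X\<close> and leaves
    \<open>card ?D\<close>.\<close>
  have "insert u (?X \<union> ?D) \<subseteq> E `` {v}"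
    using uv E_sym by auto
  then have "card (insert u (?X \<union> ?D)) \<le> card (E `` {v})"
    by (intro card_mono) auto
  moreover have "finite ?X"
    using separation_props(2)[OF sep(1)] by simp
  moreover have "u \<notin> ?X \<union> ?D" "?X \<inter> ?D = {}"
    using E_sym by auto
  ultimately have "card ?X + card ?D + 1 \<le> card (E `` {v})"
    by (simp add: card_Un_disjoint)
  moreover have "k * (card C + 2) = k * card C + 2 * k"
    by (simp add: algebra_simps)
  ultimately have "card (E `` {u}) + card ?D + j \<le> 2 * k"
    using count le lt by linarith
  then show ?thesis
    using large_degree[OF uvV(1)] by simp
qed

text \<open>Every piece has at least \<open>k\<close> neighbours; one whose cut meets
  \<open>F\<close> is no fragment and so has more, which supplies the unit of slack.\<close>

lemma sum_card_nbrs_ge: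
  assumes sep: "separation V E S (insert {u, v} C)" "{u, v} \<notin> C"
  shows "k * card C \<le> (\<Sum>Z\<in>C. card (nbrs E Z))"
    and "Z \<in> C \<Longrightarrow> nbrs E Z \<inter> F \<noteq> {} \<Longrightarrow> k * card C + 1 \<le> (\<Sum>Z\<in>C. card (nbrs E Z))"
proof -
  have fin: "finite C"
    using separation_props(1)[OF sep(1)] by simp
  have C: "W \<subseteq> V" "W \<noteq> {}" "W \<union> nbrs E W \<noteq> V" if "W \<in> C" for W
  proof -
    have "card (insert {u, v} C) \<ge> 2"
      using sep(2) fin that by (simp add: card_gt_0_iff Suc_le_eq) blast
    then show "W \<union> nbrs E W \<noteq> V"
      using piece_closed_nbhd_neq[OF sep(1)] that by blast
  qed (use separation_props(3,4)[OF sep(1)] that in blast)+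
  have ge: "k \<le> card (nbrs E W)" if "W \<in> C" for W
    using le_card_nbrs[OF C[OF that]] .
  have "k * card C = (\<Sum>Z\<in>C. k)"
    by simp
  also have "\<dots> \<le> (\<Sum>Z\<in>C. card (nbrs E Z))"
    using ge by (intro sum_mono)
  finally show "k * card C \<le> (\<Sum>Z\<in>C. card (nbrs E Z))" .
  assume Z: "Z \<in> C" "nbrs E Z \<inter> F \<noteq> {}"
  then have "k < card (nbrs E Z)"
    using F_avoids[of Z] C[OF Z(1)] ge[OF Z(1)] by (auto simp: fragment_def)
  then have "(\<Sum>Z\<in>C. k) < (\<Sum>Z\<in>C. card (nbrs E Z))"
    using fin ge Z(1) by (intro sum_strict_mono_ex1) auto
  then show "k * card C + 1 \<le> (\<Sum>Z\<in>C. card (nbrs E Z))"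
    by (simp add: mult.commute)
qed

text \<open>The critical separation is found from \<open>u \<in> F\<close> but is symmetric in
  \<open>u\<close> and \<open>v\<close>, so \<open>private_nbrs_le\<close> applies with the roles
  exchanged and slack 0.\<close>

lemma private_nbrs_le_inner:
  assumes "u \<in> F" "(u, v) \<in> E"
  shows "3 * card (E `` {u} - insert v (E `` {v})) \<le> k + 2"
proof -
  obtain S C where sep: "separation V E S (insert {u, v} C)" "{u, v} \<notin> C"
    and lt: "2 * card S < k * (card C + 2)"
    and count: "(\<Sum>Z\<in>C. card (nbrs E Z)) + card (E `` {u}) + card (E `` {v})
      \<le> 2 * card S + card {s\<in>S. (s, u) \<in> E \<and> (s, v) \<in> E \<and> s \<in> E `` \<Union>C} + 2"
    using obtain_critical_separation[OF assms] by blast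
  have eq: "{u, v} = {v, u}" "{s\<in>S. (s, u) \<in> E \<and> (s, v) \<in> E \<and> s \<in> E `` \<Union>C}
      = {s\<in>S. (s, v) \<in> E \<and> (s, u) \<in> E \<and> s \<in> E `` \<Union>C}"
    by auto
  show ?thesis
    using private_nbrs_le[OF E_sym[OF assms(2)], of S C 0] sep lt count
      sum_card_nbrs_ge(1)[OF sep] unfolding eq by simp
qed

text \<open>
  If no vertex of \<open>F\<close> were a common neighbour counted in the critical separation of an edge leaving
  \<open>F\<close>, then these common neighbours would lie in \<open>nbrs E F - {v}\<close>, which has only \<open>k - 1\<close> elements.
\<close>

lemma obtain_common_nbr_inside:
  assumes u: "u \<in> F" and v: "v \<in> nbrs E F" and uv: "(u, v) \<in> E"
  obtains S C w Z where "separation V E S (insert {u, v} C)" "{u, v} \<notin> C"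
    "2 * card S < k * (card C + 2)" "2 \<le> card C"
    "w \<in> F" "w \<in> S" "(w, v) \<in> E" "Z \<in> C" "w \<in> E `` Z"
    "3 * card (E `` {v} - insert u (E `` {u})) + 1 \<le> k"
proof -
  obtain S C where sep: "separation V E S (insert {u, v} C)" "{u, v} \<notin> C" and "C \<noteq> {}"
    and lt: "2 * card S < k * (card C + 2)"
    and count: "(\<Sum>Z\<in>C. card (nbrs E Z)) + card (E `` {u}) + card (E `` {v})
      \<le> 2 * card S + card {s\<in>S. (s, u) \<in> E \<and> (s, v) \<in> E \<and> s \<in> E `` \<Union>C} + 2"
    using obtain_critical_separation[OF u uv] by blast
  define X where "X = {s\<in>S. (s, u) \<in> E \<and> (s, v) \<in> E \<and> s \<in> E `` \<Union>C}"
  have uvV: "u \<in> V" "v \<in> V"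
    using uv E_subset by auto
  have FV: "card (nbrs E F) = k"
    using F by (auto simp: fragment_def)
  have fin: "finite S" "finite C"
    using separation_props[OF sep(1)] by auto
  have deg: "5 * k \<le> 3 * card (E `` {u}) + 2" "5 * k \<le> 3 * card (E `` {v}) + 2"
    using large_degree uvV by auto
  have k2: "k * (card C + 2) = k * card C + 2 * k"
    by (simp add: algebra_simps)
  have C_nadj: "E `` {u, v} \<inter> Z = {}" "Z \<subseteq> V - S" if "Z \<in> C" for Z
    using that sep separationD(2)[OF sep(1), of "{u, v}" Z] separation_props(3)[OF sep(1), of Z] by auto
  have "X \<inter> F \<noteq> {}"
  proof
    assume "X \<inter> F = {}"
    moreover have "X \<subseteq> F \<union> nbrs E F"
      using u E_sym by (auto simp: X_def nbrs_def)
    moreover have "v \<notin> X"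
      by (auto simp: X_def)
    ultimately have "X \<subseteq> nbrs E F - {v}"
      by auto
    then have "card X \<le> k - 1"
      using v FV by (metis card_Diff_singleton card_mono finite_Diff finite_nbrs)
    then have bound: "k * card C + card (E `` {u}) + card (E `` {v}) \<le> 2 * card S + (k - 1) + 2"
      using count sum_card_nbrs_ge(1)[OF sep] unfolding X_def by linarith
    \<comment> \<open>The two degrees sum to at most \<open>3k\<close> but to at least
      \<open>(10k - 4)/3\<close>.\<close>
    then have "k = 4"
      using lt k2 deg k_ge_4 by linarith
    \<comment> \<open>Both degrees are at least 6, so \<open>2 * card S = 4 * card C + 7\<close>,
      which fails by parity.\<close>
    then show False
      using bound lt k2 deg by presburger
  qed
  then obtain w Z where w: "w \<in> F" "w \<in> X" and Z: "Z \<in> C" "w \<in> E `` Z"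
    by (auto simp: X_def)
  then have wS: "w \<in> S" "(w, v) \<in> E"
    by (auto simp: X_def)
  have "w \<in> nbrs E Z"
    using Z wS C_nadj(2)[OF Z(1)] by (auto simp: nbrs_def)
  then have "k * card C + 1 \<le> (\<Sum>Z\<in>C. card (nbrs E Z))"
    using sum_card_nbrs_ge(2)[OF sep Z(1)] w(1) by blast
  then have "3 * (card (E `` {v} - insert u (E `` {u})) + 1) \<le> k + 2"
    by (rule private_nbrs_le[OF uv sep lt count])
  then have D: "3 * card (E `` {v} - insert u (E `` {u})) + 1 \<le> k"
    by simp
  \<comment> \<open>With one further piece, \<open>2 * card S < 3 * k\<close>. The neighbours of
    \<open>u\<close> except \<open>v\<close> lie in \<open>S\<close>, and so does a neighbour
    \<open>z\<close> of \<open>v\<close> on the far side of \<open>F\<close>. So \<open>u\<close>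
    has degree at most \<open>card S\<close>, which is too small; \<open>z\<close> saves the unit
    that matters for small \<open>k\<close>.\<close>
  have "2 \<le> card C"
  proof (rule ccontr)
    assume "\<not> 2 \<le> card C"
    then have "card C = 1"
      using \<open>C \<noteq> {}\<close> fin by (metis One_nat_def Suc_1 card_eq_0_iff less_2_cases_iff not_le)
    then have lt3: "2 * card S < 3 * k"
      using lt by simp
    have "v \<in> nbrs E (V - F - nbrs E F)"
      using v fragment_complement[OF F] by simp
    then obtain z where z: "(v, z) \<in> E" "z \<in> V" "z \<notin> F" "z \<notin> nbrs E F"
      using E_sym by (auto simp: nbrs_def)
    then have zu: "(u, z) \<notin> E" "z \<noteq> u" "z \<noteq> v"
      using u v by (auto simp: nbrs_def)
    have U: "\<Union>(insert {u, v} C) = V - S"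
      using sep(1) by (auto simp: separation_def partition_on_def)
    have in_S: "y \<in> S" if "y \<in> E `` {u, v}" "y \<noteq> u" "y \<noteq> v" for y
    proof (rule ccontr)
      assume "y \<notin> S"
      then have "y \<in> \<Union>(insert {u, v} C)"
        using that Image_subset[of "{u, v}"] unfolding U by blast
      then show False
        using that C_nadj(1) by blast
    qed
    have "z \<in> S"
      using in_S[of z] z zu by auto
    have "E `` {u} - {v} \<subseteq> S - {z}"
    proof
      fix y assume "y \<in> E `` {u} - {v}"
      then show "y \<in> S - {z}"
        using in_S[of y] zu by (cases "y = u") auto
    qed
    then have "card (E `` {u} - {v}) \<le> card (S - {z})"
      using fin by (intro card_mono) auto
    then have "card (E `` {u}) \<le> card S"
      using card_Suc_Diff1[of "E `` {u}" v] card_Suc_Diff1[of S z] \<open>z \<in> S\<close> uv fin by simp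
    then show False
      using deg(1) lt3 k_ge_4 by linarith
  qed
  with that sep lt w(1) wS Z D show thesis
    by blast
qed

text \<open>
  For an edge \<open>uv\<close> leaving \<open>F\<close> take a common neighbour \<open>w\<close> inside \<open>F\<close> with a neighbour \<open>c\<close> in
  another piece \<open>Z\<close>. Going from \<open>v\<close> to \<open>w\<close> and from \<open>w\<close> to \<open>c\<close> hardly changes the closed
  neighbourhood, so most neighbours of \<open>v\<close> are neighbours of \<open>Z\<close>; but those are fewer than \<open>k\<close>,
  since removing them from the separator merges just two pieces.
\<close>

lemma avoiding_fragment_False: False
proof -
  have "card (nbrs E F) \<noteq> 0"
    using F k_ge_4 by (simp add: fragment_def)
  then obtain v where v: "v \<in> nbrs E F"
    by (metis card.empty equals0I)
  then obtain u where u: "u \<in> F" and uv: "(u, v) \<in> E"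
    by (auto simp: nbrs_def)
  obtain S C w Z where sep: "separation V E S (insert {u, v} C)" "{u, v} \<notin> C"
    and lt: "2 * card S < k * (card C + 2)" and "2 \<le> card C"
    and w: "w \<in> F" "w \<in> S" "(w, v) \<in> E" and Z: "Z \<in> C" "w \<in> E `` Z"
    by (rule obtain_common_nbr_inside[OF u v uv]) (rule that)
  obtain c where c: "c \<in> Z" "(w, c) \<in> E"
    using Z(2) E_sym by blast
  have fin: "finite S" "finite C"
    using separation_props[OF sep(1)] by auto
  have ne: "{u, v} \<noteq> Z"
    using sep(2) Z(1) by blast
  have uvZ: "E `` {u, v} \<inter> Z = {}" "E `` Z \<inter> {u, v} = {}"
    using separationD(2)[OF sep(1), of "{u, v}" Z] separationD(2)[OF sep(1), of Z "{u, v}"] Z(1) ne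
    by auto
  let ?Y = "S \<inter> E `` {u, v} \<inter> E `` Z"
  let ?D = "E `` {v} - insert w (E `` {w})" and ?D' = "E `` {w} - insert c (E `` {c})"
  have "card (insert {u, v} C) = card C + 1"
    using sep(2) fin by simp
  then have "k * card C + 2 * card ?Y \<le> 2 * card S"
    using card_common_nbrs_le[OF sep(1) _ _ _ ne] \<open>2 \<le> card C\<close> Z(1) by simp
  moreover have "k * (card C + 2) = k * card C + 2 * k"
    by (simp add: algebra_simps)
  ultimately have Y: "card ?Y < k"
    using lt by linarith
  \<comment> \<open>Now \<open>w\<close> takes the role of \<open>u\<close>, as \<open>wv\<close>
    also leaves \<open>F\<close>; only the bound is taken from the result.\<close>
  have D: "3 * card ?D + 1 \<le> k"
    by (rule obtain_common_nbr_inside[OF w(1) v w(3)])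
  have D': "3 * card ?D' \<le> k + 2"
    using private_nbrs_le_inner[OF w(1) c(2)] .
  \<comment> \<open>A neighbour of \<open>v\<close> outside \<open>?D\<close> and \<open>?D'\<close>
    is \<open>w\<close> or a neighbour of \<open>c\<close>, hence in \<open>?Y\<close>;
    \<open>v\<close> itself is in \<open>?D'\<close>.\<close>
  have "insert v (E `` {v}) \<subseteq> ?Y \<union> ?D \<union> ?D'"
  proof
    fix z assume z: "z \<in> insert v (E `` {v})"
    have cv: "(v, c) \<notin> E" "(c, v) \<notin> E" "c \<noteq> v"
      using uvZ c(1) separationD(1)[OF sep(1), of "{u, v}" Z] Z(1) ne by auto
    have "w \<in> ?Y"
      using w Z(2) E_sym by auto
    show "z \<in> ?Y \<union> ?D \<union> ?D'"
    proof (cases "z = v \<or> z = w")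
      case True
      then show ?thesis
        using w(3) cv \<open>w \<in> ?Y\<close> by auto
    next
      case False
      then have vz: "(v, z) \<in> E"
        using z by auto
      show ?thesis
      proof (cases "(w, z) \<in> E \<and> (c, z) \<in> E")
        case True
        have "z \<notin> Z"
          using vz uvZ(1) by auto
        then have "z \<in> nbrs E Z"
          using True c(1) by (auto simp: nbrs_def)
        then have "z \<in> S"
          using separation_nbrs_piece[OF sep(1), of Z] Z(1) by auto
        then show ?thesis
          using vz True c(1) by auto
      next
        case no: False
        have "z \<noteq> c"
          using vz cv by auto
        then show ?thesis
          using no vz False by auto
      qed
    qed
  qed
  then have "card (insert v (E `` {v})) \<le> card (?Y \<union> ?D \<union> ?D')"
    using fin by (intro card_mono) auto
  also have "\<dots> \<le> card ?Y + card ?D + card ?D'"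
    by (rule card_Un3_le)
  finally have "card (E `` {v}) + 1 \<le> card ?Y + card ?D + card ?D'"
    by simp
  moreover have "v \<in> V"
    using uv E_subset by auto
  \<comment> \<open>Three times the degree of \<open>v\<close> is at most
    \<open>3(k - 1) + (k - 1) + (k + 2) - 3 = 5k - 5\<close>.\<close>
  ultimately show False
    using large_degree[of v] Y D D' by linarith
qed

end

lemma (in large_degree_graph) no_fragment: "\<not> fragment k V E Z"
proof
  assume "fragment k V E Z"
  then obtain F where "fragment k V E F" "\<And>A. fragment k V E A \<Longrightarrow> nbrs E A \<inter> F = {}"
    using obtain_fragment_avoiding_cuts by blast
  then interpret avoiding_fragment V E k F
    by unfold_locales
  show False by (rule avoiding_fragment_False)
qed

section \<open>Components and separations\<close>

context pair_graph
begin

lemma sym_digraph_delete_verts: "sym_digraph (delete_verts G S)"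
proof -
  interpret D: wf_digraph "delete_verts G S"
    unfolding delete_verts_def by (rule wellformed_induce_subgraph)
  have "symmetric (delete_verts G S)"
    unfolding delete_verts_def
    by (rule induced_graph_imp_symmetric[OF pair_sym_arcs]) (auto intro: induced_induce)
  then show ?thesis
    by unfold_locales
qed

lemma dominates_delete_verts:
  "a \<rightarrow>\<^bsub>delete_verts G S\<^esub> b \<longleftrightarrow> (a, b) \<in> parcs G \<and> a \<notin> S \<and> b \<notin> S"
  using wellformed' by (fastforce simp: delete_verts_def arcs_ends_def arc_to_ends_def image_iff)

lemma verts_delete_verts [simp]: "verts (delete_verts G S) = pverts G - S"
  by (simp add: delete_verts_def)

lemma num_components_eq:
  "num_components (delete_verts G S) = card (pre_digraph.sccs_verts (delete_verts G S))"
proof -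
  interpret D: sym_digraph "delete_verts G S"
    by (rule sym_digraph_delete_verts)
  show ?thesis
    by (simp add: num_components_def D.card_sccs_verts)
qed

lemma finite_sccs_verts_delete: "finite (pre_digraph.sccs_verts (delete_verts G S))"
proof -
  interpret D: sym_digraph "delete_verts G S"
    by (rule sym_digraph_delete_verts)
  have "pre_digraph.sccs_verts (delete_verts G S) \<subseteq> Pow (pverts G)"
    using D.sccs_verts_subsets by auto
  then show ?thesis
    using pair_finite_verts finite_subset by blast
qed

lemma separation_sccs_verts:
  assumes "S \<subseteq> pverts G"
  shows "separation (pverts G) (parcs G) S (pre_digraph.sccs_verts (delete_verts G S))"
proof -
  let ?D = "delete_verts G S"
  interpret D: sym_digraph ?D
    by (rule sym_digraph_delete_verts)
  have "\<Union>D.sccs_verts = pverts G - S"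
  proof
    show "\<Union>D.sccs_verts \<subseteq> pverts G - S"
      using D.sccs_verts_subsets by auto
    show "pverts G - S \<subseteq> \<Union>D.sccs_verts"
      using D.scc_of_in_sccs_verts D.in_scc_of_self by fastforce
  qed
  moreover have "disjoint D.sccs_verts"
    using D.sccs_verts_disjoint by (auto simp: disjoint_def)
  moreover have "{} \<notin> D.sccs_verts"
    by (simp add: D.in_sccs_verts_conv_reachable)
  moreover have "parcs G `` A \<inter> B = {}" if AB: "A \<in> D.sccs_verts" "B \<in> D.sccs_verts" "A \<noteq> B" for A B
  proof (rule ccontr)
    assume "parcs G `` A \<inter> B \<noteq> {}"
    then obtain a b where ab: "a \<in> A" "b \<in> B" "(a, b) \<in> parcs G"
      by blast
    then have "a \<rightarrow>\<^bsub>?D\<^esub> b"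
      using AB D.sccs_verts_subsets by (auto simp: dominates_delete_verts)
    then have "a \<rightarrow>\<^sup>*\<^bsub>?D\<^esub> b"
      by blast
    moreover from this have "b \<rightarrow>\<^sup>*\<^bsub>?D\<^esub> a"
      by (rule D.symmetric_reachable')
    ultimately have "b \<in> A"
      using AB(1) ab(1) by (auto simp: D.in_sccs_verts_conv_reachable)
    then show False
      using D.sccs_verts_disjoint[OF AB] ab(2) by blast
  qed
  ultimately show ?thesis
    using assms unfolding separation_def partition_on_def by (intro conjI ballI impI)
qed

text \<open>A piece is closed under reachability in the remaining graph, so it contains a component,
  and disjoint pieces contain different ones.\<close>

lemma card_pieces_le_num_components:
  assumes sep: "separation (pverts G) (parcs G) S P"
  shows "card P \<le> num_components (delete_verts G S)"
proof -
  let ?D = "delete_verts G S"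
  interpret D: sym_digraph ?D
    by (rule sym_digraph_delete_verts)
  have part: "\<Union>P = pverts G - S" "{} \<notin> P"
    using sep by (auto simp: separation_def partition_on_def)
  have closed: "y \<in> Z" if "x \<rightarrow>\<^sup>*\<^bsub>?D\<^esub> y" "Z \<in> P" "x \<in> Z" for x y Z
    using that(1)
  proof (induction rule: D.reachable_induct)
    case base
    then show ?case using that(3) by simp
  next
    case (step y z)
    then have "(y, z) \<in> parcs G" "z \<in> pverts G - S"
      using wellformed' by (auto simp: dominates_delete_verts)
    then obtain W where "W \<in> P" "z \<in> W"
      using part(1) by blast
    then show ?case
      using separationD(2)[OF sep that(2), of W] \<open>(y, z) \<in> parcs G\<close> step.IH by blast
  qed
  have "\<exists>T\<in>D.sccs_verts. T \<subseteq> Z \<and> T \<noteq> {}" if Z: "Z \<in> P" for Z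
  proof -
    obtain z where z: "z \<in> Z"
      using part(2) Z by (metis equals0I)
    then have "z \<in> verts ?D"
      using part(1) Z by auto
    then have "D.scc_of z \<in> D.sccs_verts" "z \<in> D.scc_of z"
      by (simp_all add: D.scc_of_in_sccs_verts D.in_scc_of_self)
    moreover have "D.scc_of z \<subseteq> Z"
      using closed[OF _ Z z] by (auto simp: D.scc_of_def)
    ultimately show ?thesis by blast
  qed
  then obtain f where f: "\<And>Z. Z \<in> P \<Longrightarrow> f Z \<in> D.sccs_verts \<and> f Z \<subseteq> Z \<and> f Z \<noteq> {}"
    by metis
  have "inj_on f P"
  proof (rule inj_onI, rule ccontr)
    fix Z W assume "Z \<in> P" "W \<in> P" "f Z = f W" "Z \<noteq> W"
    then show False
      using separationD(1)[OF sep, of Z W] f[of Z] f[of W] by blast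
  qed
  moreover have "f ` P \<subseteq> D.sccs_verts"
    using f by blast
  ultimately show ?thesis
    using finite_sccs_verts_delete by (simp add: num_components_eq card_inj_on_le)
qed

section \<open>Toughness in terms of separations\<close>

lemma complete_graph_iff:
  "complete_graph G \<longleftrightarrow> (\<forall>a\<in>pverts G. \<forall>b\<in>pverts G. a \<noteq> b \<longrightarrow> (a, b) \<in> parcs G)"
proof -
  have "(u, v) \<in> parcs G \<Longrightarrow> u \<in> pverts G \<and> v \<in> pverts G \<and> u \<noteq> v" for u v
    using wellformed' pair_no_loops[of "(u, v)"] by auto
  then have "parcs G = {(u, v). (u, v) \<in> pverts G \<times> pverts G \<and> u \<noteq> v}
      \<longleftrightarrow> (\<forall>a\<in>pverts G. \<forall>b\<in>pverts G. a \<noteq> b \<longrightarrow> (a, b) \<in> parcs G)"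
    by (auto simp: set_eq_iff)
  then show ?thesis
    using pair_finite_verts by (simp add: complete_graph_def complete_digraph_pair_def)
qed

lemma toughness_attained:
  assumes "\<not> complete_graph G"
  obtains S P where "separation (pverts G) (parcs G) S P" "2 \<le> card P"
    "toughness G = ereal (real (card S) / real (card P))"
proof -
  let ?M = "{ereal (real (card S) / real (num_components (delete_verts G S))) | S.
    S \<subseteq> pverts G \<and> num_components (delete_verts G S) \<ge> 2}"
  obtain a b where ab: "a \<in> pverts G" "b \<in> pverts G" "a \<noteq> b" "(a, b) \<notin> parcs G"
    using assms by (auto simp: complete_graph_iff)
  \<comment> \<open>Keeping only two non-adjacent vertices leaves two components, so the minimum is
    over a non-empty set.\<close>
  then have "separation (pverts G) (parcs G) (pverts G - {a, b}) {{a}, {b}}"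
    using pair_sym_arcs by (auto simp: separation_def partition_on_def disjoint_def symmetric_def dest: symD)
  then have "2 \<le> num_components (delete_verts G (pverts G - {a, b}))"
    using card_pieces_le_num_components ab(3) by fastforce
  then have "?M \<noteq> {}" by blast
  moreover have "finite ?M"
    using pair_finite_verts by (auto intro: finite_subset[of _ "Pow (pverts G)"])
  ultimately have "Min ?M \<in> ?M" by (rule Min_in[rotated])
  then obtain S where S: "S \<subseteq> pverts G" "num_components (delete_verts G S) \<ge> 2"
    "toughness G = ereal (real (card S) / real (num_components (delete_verts G S)))"
    using assms by (auto simp: toughness_def)
  then show thesis
    using that[OF separation_sccs_verts[OF S(1)]] by (simp add: num_components_eq)
qed

text \<open>There are at most as many pieces as components, so with \<open>0 \<le> t\<close> the
  bound passes from components to pieces.\<close>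

lemma le_card_if_toughness:
  assumes t: "toughness G = ereal t" "0 \<le> t"
    and sep: "separation (pverts G) (parcs G) S P" "2 \<le> card P"
  shows "t * card P \<le> card S"
proof -
  let ?M = "{ereal (real (card S) / real (num_components (delete_verts G S))) | S.
    S \<subseteq> pverts G \<and> num_components (delete_verts G S) \<ge> 2}" and ?n = "num_components (delete_verts G S)"
  have le: "card P \<le> ?n"
    using card_pieces_le_num_components[OF sep(1)] .
  then have "ereal (real (card S) / real ?n) \<in> ?M"
    using sep by (auto simp: separation_def)
  moreover have "finite ?M"
    using pair_finite_verts by (auto intro: finite_subset[of _ "Pow (pverts G)"])
  ultimately have "Min ?M \<le> ereal (real (card S) / real ?n)"
    by (rule Min_le[rotated])
  moreover have "\<not> complete_graph G"
    using t(1) by (auto simp: toughness_def)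
  then have "Min ?M = ereal t"
    using t(1) by (simp add: toughness_def)
  ultimately have "ereal t \<le> ereal (real (card S) / real ?n)"
    by simp
  then have "t * ?n \<le> card S"
    using le sep(2) by (simp add: field_simps)
  moreover have "t * card P \<le> t * ?n"
    using t(2) le by (intro mult_left_mono) auto
  ultimately show ?thesis by linarith
qed

lemma pair_graph_delete_edge: "pair_graph (delete_edge G e)"
proof -
  have "symmetric (delete_edge G e)"
    using pair_sym_arcs by (auto simp: symmetric_def sym_def delete_edge_def)
  then show ?thesis
    using wellformed' pair_no_loops pair_finite_verts pair_finite_arcs
    by unfold_locales (auto simp: delete_edge_def)
qed

lemma claw_freeD:
  assumes cf: "claw_free G"
    and s: "(s, a) \<in> parcs G" "(s, b) \<in> parcs G" "(s, c) \<in> parcs G" and d: "a \<noteq> b" "a \<noteq> c" "b \<noteq> c"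
  shows "(a, b) \<in> parcs G \<or> (a, c) \<in> parcs G \<or> (b, c) \<in> parcs G"
proof (rule ccontr)
  assume no: "\<not> ?thesis"
  have sym: "(y, x) \<in> parcs G" if "(x, y) \<in> parcs G" for x y
    using pair_sym_arcs that by (auto simp: symmetric_def dest: symD)
  have irr: "(x, x) \<notin> parcs G" for x
    using pair_no_loops[of "(x, x)"] by auto
  have non_adj: "(x, y) \<notin> parcs G" if "x \<in> {a, b, c}" "y \<in> {a, b, c}" for x y
    using that no irr sym[of b a] sym[of c a] sym[of c b] by blast
  have V: "{s, a, b, c} \<subseteq> pverts G"
    using s wellformed' by blast
  define H where "H = \<lparr>pverts = {s, a, b, c}, parcs = {s} \<times> {a, b, c} \<union> {a, b, c} \<times> {s}\<rparr>"
  have "s \<notin> {a, b, c}"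
    using s irr by auto
  have "K\<^bsub>1,3\<^esub> (with_proj H)"
    unfolding complete_bipartite_digraph_pair_def
  proof (intro conjI exI)
    show "pverts H = {s} \<union> {a, b, c}" "parcs H = {s} \<times> {a, b, c} \<union> {a, b, c} \<times> {s}"
      by (auto simp: H_def)
    show "{s} \<inter> {a, b, c} = {}"
      using \<open>s \<notin> {a, b, c}\<close> by auto
    show "card {a, b, c} = 3"
      using d by simp
  qed (auto simp: H_def)
  moreover have "induced_subgraph (with_proj H) (with_proj G)"
  proof (rule induced_subgraphI)
    have "wf_digraph (with_proj H)"
      by unfold_locales (auto simp: H_def)
    then show "subgraph (with_proj H) (with_proj G)"
      using V s sym wf_digraph_axioms by (auto simp: subgraph_def compatible_def H_def)
    have "{e \<in> parcs G. fst e \<in> {s, a, b, c} \<and> snd e \<in> {s, a, b, c}} \<subseteq> parcs H"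
    proof
      fix e assume e: "e \<in> {e \<in> parcs G. fst e \<in> {s, a, b, c} \<and> snd e \<in> {s, a, b, c}}"
      have star: "e \<in> {s} \<times> T \<union> T \<times> {s}"
        if "fst e \<in> insert s T" "snd e \<in> insert s T" "e \<notin> T \<times> T" "e \<noteq> (s, s)" for T
        using that by (cases e) auto
      have "e \<in> {s} \<times> {a, b, c} \<union> {a, b, c} \<times> {s}"
      proof (rule star)
        show "e \<notin> {a, b, c} \<times> {a, b, c}"
          using e non_adj[of "fst e" "snd e"] by (cases e) (simp only: mem_Times_iff mem_Collect_eq fst_conv snd_conv, blast)
        show "e \<noteq> (s, s)"
          using e irr by (cases e) (simp only: mem_Collect_eq, metis)
      qed (use e in \<open>simp_all only: mem_Collect_eq\<close>)
      then show "e \<in> parcs H"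
        by (simp only: H_def pair_pre_digraph.simps)
    qed
    moreover have "parcs H \<subseteq> parcs G"
      using s sym by (auto simp: H_def)
    ultimately show "arcs (with_proj H)
      = {e \<in> arcs (with_proj G). tail (with_proj G) e \<in> verts (with_proj H) \<and> head (with_proj G) e \<in> verts (with_proj H)}"
      by (auto simp: H_def)
  qed
  ultimately show False
    using cf by (auto simp: claw_free_def)
qed

lemma out_degree_eq: "out_degree (with_proj G) v = card (parcs G `` {v})"
proof -
  have "out_arcs (with_proj G) v = Pair v ` (parcs G `` {v})"
    by (auto simp: out_arcs_def)
  then show ?thesis
    by (simp add: out_degree_def card_image inj_on_def)
qed

end

section \<open>The degree bound for minimally tough claw-free graphs\<close>

theorem theorem1p8:
  fixes G :: "'a pair_pre_digraph" and t :: real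
  assumes "pair_graph G"
    and "t \<ge> 2"
    and "minimally_tough t G"
    and "claw_free G"
  shows "\<exists>v \<in> pverts G. int (out_degree (with_proj G) v) \<le> \<lceil>(10 * t - 5) / 3\<rceil>"
proof (rule ccontr)
  assume no: "\<not> ?thesis"
  interpret pair_graph G by fact
  have t: "toughness G = ereal t"
    using assms(3) by (simp add: minimally_tough_def)
  then have nc: "\<not> complete_graph G"
    by (auto simp: toughness_def)
  have tough: "t * card P \<le> card S" if "separation (pverts G) (parcs G) S P" "2 \<le> card P" for S P
    using le_card_if_toughness[OF t _ that] assms(2) by simp
  interpret claw_free_graph "pverts G" "parcs G"
  proof
    show "(y, x) \<in> parcs G" if "(x, y) \<in> parcs G" for x y
      using pair_sym_arcs that by (auto simp: symmetric_def dest: symD)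
    show "(x, x) \<notin> parcs G" for x
      using pair_no_loops[of "(x, x)"] by auto
  qed (use pair_finite_verts wellformed' claw_freeD[OF assms(4)] in auto)
  obtain S P where "separation (pverts G) (parcs G) S P" "2 \<le> card P"
    "toughness G = ereal (real (card S) / real (card P))"
    using toughness_attained[OF nc] .
  then obtain k Z where k: "real k = 2 * t" and Z: "fragment k (pverts G) (parcs G) Z"
    using fragment_if_toughness_attained[of t S P] tough t by (auto simp: field_simps)
  interpret large_degree_graph "pverts G" "parcs G" k
  proof
    show "k * card P \<le> 2 * card S" if "separation (pverts G) (parcs G) S P" "2 \<le> card P" for S P
    proof -
      have "real (k * card P) \<le> real (2 * card S)"
        using tough[OF that] k by simp
      then show ?thesis by (simp only: of_nat_le_iff)
    qed
    show "5 * k \<le> 3 * card (parcs G `` {v}) + 2" if "v \<in> pverts G" for v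
    proof -
      \<comment> \<open>Integrality of the degree gains the 1, and
        \<open>(10t - 5)/3 + 1 = (5k - 2)/3\<close>.\<close>
      have "\<lceil>(10 * t - 5) / 3\<rceil> + 1 \<le> int (card (parcs G `` {v}))"
        using no that by (auto simp: out_degree_eq not_le)
      then have "(10 * t - 5) / 3 + 1 \<le> real (card (parcs G `` {v}))"
        by linarith
      then have "real (5 * k) \<le> real (3 * card (parcs G `` {v}) + 2)"
        using k by (simp add: field_simps)
      then show ?thesis by (simp only: of_nat_le_iff)
    qed
    show "4 \<le> k"
      using k assms(2) by linarith
    show "\<exists>S P. separation (pverts G) (parcs G - {(u, v), (v, u)}) S P \<and>
      2 \<le> card P \<and> 2 * card S < k * card P" if uv: "(u, v) \<in> parcs G" for u v
    proof -
      let ?H = "delete_edge G (u, v)"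
      interpret H: pair_graph ?H
        by (rule pair_graph_delete_edge)
      have H: "pverts ?H = pverts G" "parcs ?H = parcs G - {(u, v), (v, u)}"
        by (simp_all add: delete_edge_def)
      have "u \<in> pverts G" "v \<in> pverts G" "u \<noteq> v"
        using uv wellformed' pair_no_loops[of "(u, v)"] by auto
      \<comment> \<open>The ends of the deleted edge are not adjacent, so the toughness of
        \<open>?H\<close> is attained by a separation.\<close>
      then have "\<not> complete_graph ?H"
        unfolding H.complete_graph_iff H by blast
      then obtain S P where SP: "separation (pverts ?H) (parcs ?H) S P" "2 \<le> card P"
        "toughness ?H = ereal (real (card S) / real (card P))"
        using H.toughness_attained by blast
      moreover have "toughness ?H < ereal t"
        using assms(3) uv by (auto simp: minimally_tough_def)
      ultimately have "card S < t * card P"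
        by (simp add: field_simps)
      then have "real (2 * card S) < real (k * card P)"
        using k by simp
      then have "2 * card S < k * card P" by (simp only: of_nat_less_iff)
      then show ?thesis
        using SP H by auto
    qed
  qed
  show False
    using no_fragment Z by blast
qed

end
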